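(* Let $d\ge1$ and let $F,G$ be distribution functions on $[0,\infty)$ such that $F$ strictly dominates $G$. For $d=1$, assume additionally that $$F(0)<e^{-\beta_G(1)} .$$ Then there exists a constant $0<c<\infty$ (which may depend on $d$, $F$ and $G$) such that for all $x\in\mathbb{R}^d\setminus\{0\}$, $$\beta_F(x)-\beta_G(x)\ge c\,\|x\|_1 .$$
   Context: $F$ strictly dominates $G$ means: $F(t)\le G(t)$ for all $t\geq 0$, but $F\not\equiv G$. Let $(S_k)_{k\ge0}$ be the simple random walk on $\mathbb{Z}^d$, with law $P^x$ and expectation $E^x$ when started at $x$. For a distribution function $\phi$ on $[0,\infty)$ let the potential $\omega=(\omega(x))_{x\in\mathbb{Z}^d}$ be i.i.d. with distribution function $\phi$, independent of the walk, with law $\mathbb{P}$ and expectation $\mathbb{E}$. Let $H(y):=\inf\{k\ge0:S_k=y\}$ and $$e(x,y,\omega):=E^x\Bigl[\exp\Bigl\{-\sum_{k=0}^{H(y)-1}\omega(S_k)\Bigr\}\mathbf{1}_{\{H(y)<\infty\}}\Bigr]$$ ($e(x,x,\omega):=1$), and $b_\phi(x,y):=-\log\mathbb{E}[e(x,y,\omega)]$. It is known that there is a unique norm (a seminorm, namely $0$, if $\omega\equiv0$) $\beta_\phi(\cdot)$ on $\mathbb{R}^d$, called the annealed Lyapunov exponent, such that for all $x\in\mathbb{Z}^d$, $\lim_{n\to\infty}\frac1n b_\phi(0,nx)=\inf_{n\in\mathbb{N}}\frac1n b_\phi(0,nx)=\beta_\phi(x)$. $\|\cdot\|_1$ is the $\ell^1$-norm.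 *)

theory Defs
  imports "HOL-Probability.Probability"
begin

text \<open>
  The lattice is \<^typ>\<open>int ^ 'd\<close>, so \<open>d = CARD('d)\<close>.  A distribution function on
  \<open>[0, \<infinity>)\<close> is represented by its extension by \<open>0\<close> to the whole real line, which makes
  \<^const>\<open>interval_measure\<close> of it the corresponding probability measure.
\<close>

definition nonneg_distribution_function :: "(real \<Rightarrow> real) \<Rightarrow> bool" where
  "nonneg_distribution_function F \<longleftrightarrow>
     mono F \<and> (\<forall>t. continuous (at_right t) F) \<and> (\<forall>t<0. F t = 0) \<and> (F \<longlongrightarrow> 1) at_top"

definition strictly_dominates :: "(real \<Rightarrow> real) \<Rightarrow> (real \<Rightarrow> real) \<Rightarrow> bool" where
  "strictly_dominates F G \<longleftrightarrow> (\<forall>t\<ge>0. F t \<le> G t) \<and> (\<exists>t\<ge>0. F t \<noteq> G t)"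

definition potential_law :: "(real \<Rightarrow> real) \<Rightarrow> (int ^ 'd \<Rightarrow> real) measure" where
  "potential_law \<phi> = PiM UNIV (\<lambda>_. interval_measure \<phi>)"

definition walk_step :: "(int ^ 'd) pmf" where
  "walk_step = pmf_of_set (range (\<lambda>i. axis i 1) \<union> range (\<lambda>i. axis i (- 1)))"

definition walk_law :: "int ^ 'd \<Rightarrow> (nat \<Rightarrow> int ^ 'd) measure" where
  "walk_law x =
     distr (PiM UNIV (\<lambda>_::nat. measure_pmf walk_step)) (PiM UNIV (\<lambda>_. count_space UNIV))
       (\<lambda>\<xi> k. x + (\<Sum>j<k. \<xi> j))"

definition hitting_time :: "(nat \<Rightarrow> 'a) \<Rightarrow> 'a \<Rightarrow> enat" where
  "hitting_time S y = (INF k\<in>{k. S k = y}. enat k)"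

text \<open>On \<open>hitting_time S y = \<infinity>\<close> the sum below is over an infinite set, but that event does
  not contribute because of the indicator.\<close>

definition travel_weight :: "int ^ 'd \<Rightarrow> int ^ 'd \<Rightarrow> (int ^ 'd \<Rightarrow> real) \<Rightarrow> real" where
  "travel_weight x y \<omega> =
     (\<integral>S. exp (- (\<Sum>k | enat k < hitting_time S y. \<omega> (S k))) * of_bool (hitting_time S y < \<infinity>)
        \<partial>walk_law x)"

definition annealed_cost :: "(real \<Rightarrow> real) \<Rightarrow> int ^ 'd \<Rightarrow> int ^ 'd \<Rightarrow> real" where
  "annealed_cost \<phi> x y = - ln (\<integral>\<omega>. travel_weight x y \<omega> \<partial>potential_law \<phi>)"

definition seminorm :: "('a::real_vector \<Rightarrow> real) \<Rightarrow> bool" where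
  "seminorm N \<longleftrightarrow>
     (\<forall>x. 0 \<le> N x) \<and> (\<forall>c x. N (c *\<^sub>R x) = \<bar>c\<bar> * N x) \<and> (\<forall>x y. N (x + y) \<le> N x + N y)"

text \<open>A seminorm on \<open>real ^ 'd\<close> is determined by its values on the lattice (by homogeneity and
  continuity), so asking for a seminorm covers both the case where the exponent is a norm and the
  degenerate case \<open>\<omega> \<equiv> 0\<close>, where it vanishes.\<close>

definition is_annealed_lyapunov_exponent ::
    "(real \<Rightarrow> real) \<Rightarrow> (real ^ 'd \<Rightarrow> real) \<Rightarrow> bool" where
  "is_annealed_lyapunov_exponent \<phi> N \<longleftrightarrow>
     seminorm N \<and>
     (\<forall>x :: int ^ 'd.
        (\<lambda>n. annealed_cost \<phi> 0 (int n *s x) / real n) \<longlonglongrightarrow> N (\<chi> i. real_of_int (x $ i)) \<and>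
        (INF n\<in>{1..}. annealed_cost \<phi> 0 (int n *s x) / real n) = N (\<chi> i. real_of_int (x $ i)))"

definition annealed_lyapunov_exponent :: "(real \<Rightarrow> real) \<Rightarrow> real ^ 'd \<Rightarrow> real" where
  "annealed_lyapunov_exponent \<phi> = (THE N. is_annealed_lyapunov_exponent \<phi> N)"

end

theory Submission
  imports Defs
begin

text \<open>
  Integrating out the potential turns the annealed travel weight into a sum over nearest-neighbour
  paths \<open>\<gamma>\<close> from \<open>0\<close> to \<open>u\<close>, stopped on first reaching \<open>u\<close>: with
  \<open>L(k) = \<integral> e\<^sup>-\<^sup>k\<^sup>t d\<phi>(t)\<close> and \<open>\<ell>\<^sub>z\<close> the number of visits to \<open>z\<close>, the path
  \<open>\<gamma>\<close> has weight \<open>(2d)\<close> to the power \<open>-|\<gamma>|\<close> times the product of \<open>L(\<ell>\<^sub>z)\<close> over the visited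
  sites.  This passage sum depends on \<open>\<phi>\<close> only through the sequence \<open>L\<close>, which satisfies
  \<open>L(0) = 1\<close>, is nonincreasing, stays positive and fulfils \<open>L(k) L(l) \<le> L(k + l)\<close>.  The last property makes
  the passage sums supermultiplicative, so that minus their logarithm is a subadditive function on
  the lattice; rescaling it gives a seminorm, and this seminorm is the annealed Lyapunov exponent.
  Every linear comparison of the two passage costs on the lattice therefore passes to the exponents.

  Strict dominance gives \<open>L\<^sub>F(k) < L\<^sub>G(k)\<close> for each \<open>k \<ge> 1\<close>, but the ratio may tend to \<open>1\<close> as \<open>k\<close>
  grows.  So it has to be shown that typical paths visit a positive density of sites only a few
  times, or that paths which do not are too expensive.

  \<^item> For \<open>d \<ge> 2\<close> sites visited exactly once suffice: the \<open>F\<close>-weight of a path is at most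
    \<open>\<rho>\<^sup>N\<close> times its \<open>G\<close>-weight, where \<open>\<rho> = L\<^sub>F(1) / L\<^sub>G(1) < 1\<close> and \<open>N\<close> counts these sites.  Fix
    coordinates \<open>i \<noteq> k\<close>.  A path to \<open>u\<close> meets each of the \<open>|u\<^sub>i|\<close> levels of the \<open>i\<close>-th coordinate,
    and on each level the site of the path that is highest in direction \<open>k\<close> has an unvisited
    neighbour above it.  Inserting an excursion \<open>z, z + e\<^sub>k, z\<close> at any subset of
    these highest sites yields a path with that many new once-visited sites, at a bounded cost per
    site, and the excursions can be undone once the set of new sites is known.  Summing over
    all subsets on the one side and over all sets of once-visited sites on the other gives, by the
    binomial theorem, \<open>(1 + t)\<close> to the power \<open>|u\<^sub>i|\<close> times the \<open>F\<close>-sum \<open>\<le>\<close> the \<open>G\<close>-sum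
    for some \<open>t > 0\<close> (lemma \<open>passage_sum_detour_gain\<close>).

  \<^item> For \<open>d = 1\<close> there is no room for excursions, and the extra hypothesis on \<open>F(0)\<close> is what makes paths
    with many visits everywhere too expensive.  Choose \<open>F(0) < a < e\<^sup>-\<^sup>\<beta>\<close> with \<open>\<beta> = \<beta>\<^sub>G(1)\<close>.  Since
    \<open>L\<^sub>F(k) \<rightarrow> F(0)\<close>, there is an \<open>s \<in> (0, 1)\<close> with \<open>L\<^sub>F(k) \<le> L\<^sub>G(k)\<^sup>1\<^sup>-\<^sup>s a\<^sup>s\<close> for all \<open>k \<ge> 1\<close>: for large \<open>k\<close>
    because \<open>L\<^sub>F(k) \<le> a\<close>, for the finitely many others by continuity at \<open>s = 0\<close>.  A path to \<open>u\<close> visits at least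
    \<open>|u|\<close> sites, so concavity of \<open>x \<mapsto> x\<^sup>1\<^sup>-\<^sup>s\<close> bounds the \<open>F\<close>-sum by
    the power \<open>1 - s\<close> of the \<open>G\<close>-sum times \<open>a\<close> to the power \<open>s |u|\<close>
    (lemma \<open>passage_cost_interpolation\<close>).
    Hence \<open>\<beta>\<^sub>F(x) \<ge> (1 - s) \<beta> |x| + s |x| ln (1/a)\<close>, which exceeds \<open>\<beta> |x|\<close> by a multiple of \<open>|x|\<close>.
\<close>

section \<open>Sums over countable index sets\<close>

lemma nn_integral_count_space_inj_le:
  assumes "inj_on g A" "g ` A \<subseteq> B"
  shows "(\<integral>\<^sup>+x. f (g x) \<partial>count_space A) \<le> (\<integral>\<^sup>+y. f y \<partial>count_space B)"
proof -
  have "(\<integral>\<^sup>+x. f (g x) \<partial>count_space A) = (\<integral>\<^sup>+y. f y \<partial>count_space (g ` A))"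
    using assms by (intro nn_integral_bij_count_space inj_on_imp_bij_betw)
  also have "\<dots> = (\<integral>\<^sup>+y. f y * indicator (g ` A) y \<partial>count_space UNIV)"
    by (simp add: nn_integral_count_space_indicator)
  also have "\<dots> \<le> (\<integral>\<^sup>+y. f y * indicator B y \<partial>count_space UNIV)"
    using assms(2) by (intro nn_integral_mono) (auto split: split_indicator)
  also have "\<dots> = (\<integral>\<^sup>+y. f y \<partial>count_space B)"
    by (simp add: nn_integral_count_space_indicator)
  finally show ?thesis .
qed

lemma nn_integral_count_space_Sigma:
  "(\<integral>\<^sup>+x. (\<integral>\<^sup>+y. f x y \<partial>count_space (B x)) \<partial>count_space A) =
   (\<integral>\<^sup>+(x, y). f x y \<partial>count_space (Sigma A B))"
proof -
  have "(\<integral>\<^sup>+x. (\<integral>\<^sup>+y. f x y \<partial>count_space (B x)) \<partial>count_space A) =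
    (\<integral>\<^sup>+x. (\<integral>\<^sup>+y. (case (x, y) of (x, y) \<Rightarrow> f x y) * indicator (Sigma A B) (x, y) \<partial>count_space UNIV) \<partial>count_space UNIV)"
    unfolding nn_integral_count_space_indicator[of A, simplified]
    by (intro nn_integral_cong)
       (auto simp: nn_integral_count_space_indicator split: split_indicator intro!: nn_integral_cong)
  also have "\<dots> = (\<integral>\<^sup>+p. (case p of (x, y) \<Rightarrow> f x y) * indicator (Sigma A B) p \<partial>count_space UNIV)"
    by (rule nn_integral_fst_count_space)
  finally show ?thesis
    by (simp add: nn_integral_count_space_indicator)
qed

section \<open>Nearest-neighbour paths and passage sums\<close>
definition unit_steps :: "(int ^ 'd) set" where
  "unit_steps = range (\<lambda>i. axis i 1) \<union> range (\<lambda>i. axis i (- 1))"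

definition adjacent :: "int ^ 'd \<Rightarrow> int ^ 'd \<Rightarrow> bool" where
  "adjacent v w \<longleftrightarrow> w - v \<in> unit_steps"

text \<open>A path is recorded without its endpoint \<open>y\<close>: the visits that cost something are those
  at times \<open>k < H(y)\<close>.\<close>
definition first_passage_paths :: "int ^ 'd \<Rightarrow> int ^ 'd \<Rightarrow> (int ^ 'd) list set" where
  "first_passage_paths x y =
     {zs. successively adjacent (zs @ [y]) \<and> hd (zs @ [y]) = x \<and> y \<notin> set zs}"

definition step_prob :: "'d::finite itself \<Rightarrow> real" where
  "step_prob _ = 1 / real (card (unit_steps :: (int ^ 'd) set))"

abbreviation step_probability :: "(int ^ 'd::finite) list \<Rightarrow> real" where
  "step_probability zs \<equiv> step_prob TYPE('d) ^ length zs"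

definition local_time_weight :: "(nat \<Rightarrow> real) \<Rightarrow> 'a list \<Rightarrow> real" where
  "local_time_weight M zs = (\<Prod>z\<in>set zs. M (count_list zs z))"

text \<open>The passage sum is extended-real valued so that sums of paths may be rearranged freely.
  For the sequences of interest it lies in \<open>(0, 1]\<close>.\<close>
definition passage_sum :: "(nat \<Rightarrow> real) \<Rightarrow> int ^ 'd::finite \<Rightarrow> int ^ 'd \<Rightarrow> ennreal" where
  "passage_sum M x y =
     (\<integral>\<^sup>+zs. ennreal (step_probability zs * local_time_weight M zs)
        \<partial>count_space (first_passage_paths x y))"

text \<open>These properties of the sequence \<open>k \<mapsto> \<integral> e\<^sup>-\<^sup>k\<^sup>t d\<phi>(t)\<close> are all that the path arguments use
  of a single law of the potential.\<close>
locale laplace_sequence =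
  fixes M :: "nat \<Rightarrow> real"
  assumes zero: "M 0 = 1"
    and pos: "0 < M k"
    and antimono: "k \<le> l \<Longrightarrow> M l \<le> M k"
    and supermult: "M k * M l \<le> M (k + l)"
begin

lemma le_one: "M k \<le> 1"
  using antimono[of 0 k] zero by simp

lemma local_time_weight_pos: "0 < local_time_weight M zs"
  unfolding local_time_weight_def by (intro prod_pos ballI pos)

lemma local_time_weight_le_one: "local_time_weight M zs \<le> 1"
  unfolding local_time_weight_def by (intro prod_le_1) (simp add: le_one pos less_imp_le)

lemma local_time_weight_superset:
  assumes "finite S" "set zs \<subseteq> S"
  shows "local_time_weight M zs = (\<Prod>z\<in>S. M (count_list zs z))"
  unfolding local_time_weight_def using assms
  by (intro prod.mono_neutral_left) (auto simp: count_list_0_iff zero)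

lemma local_time_weight_append_le: "local_time_weight M (xs @ ys) \<le> local_time_weight M xs"
proof -
  let ?S = "set xs \<union> set ys"
  have "(\<Prod>z\<in>?S. M (count_list (xs @ ys) z)) \<le> (\<Prod>z\<in>?S. M (count_list xs z))"
    by (intro prod_mono conjI antimono) (auto simp: pos less_imp_le)
  then show ?thesis
    using local_time_weight_superset[of ?S xs] local_time_weight_superset[of ?S "xs @ ys"] by simp
qed

lemma local_time_weight_append_ge:
  "local_time_weight M xs * local_time_weight M ys \<le> local_time_weight M (xs @ ys)"
proof -
  let ?S = "set xs \<union> set ys"
  have "(\<Prod>z\<in>?S. M (count_list xs z) * M (count_list ys z)) \<le> (\<Prod>z\<in>?S. M (count_list (xs @ ys) z))"
    by (intro prod_mono conjI) (auto simp: pos less_imp_le supermult)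
  then show ?thesis
    using local_time_weight_superset[of ?S xs] local_time_weight_superset[of ?S ys]
      local_time_weight_superset[of ?S "xs @ ys"] by (simp add: prod.distrib)
qed

end

lemma unit_steps_nonempty: "(unit_steps :: (int ^ 'd) set) \<noteq> {}"
  by (simp add: unit_steps_def)

lemma finite_unit_steps: "finite (unit_steps :: (int ^ 'd::finite) set)"
  by (simp add: unit_steps_def)

lemma step_prob_pos: "0 < step_prob TYPE('d::finite)"
  by (simp add: step_prob_def unit_steps_nonempty finite_unit_steps card_gt_0_iff)

lemma uminus_unit_steps_iff [simp]: "- s \<in> unit_steps \<longleftrightarrow> s \<in> unit_steps"
proof -
  have *: "- axis i (a::int) = axis i (- a)" for i :: 'a and a
    by (simp add: vec_eq_iff axis_def)
  have "- s \<in> unit_steps" if "s \<in> unit_steps" for s :: "int ^ 'a"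
    using that by (auto simp: unit_steps_def *)
  from this[of s] this[of "- s"] show ?thesis by auto
qed

lemma adjacent_component_le: "adjacent v w \<Longrightarrow> w $ i \<le> v $ i + 1"
  by (auto simp: adjacent_def unit_steps_def axis_def vec_eq_iff split: if_splits
      dest!: spec[of _ i])

lemma not_adjacent_self: "\<not> adjacent v v"
  by (auto simp: adjacent_def unit_steps_def axis_eq_0_iff[symmetric] dest!: sym[of 0])

lemma first_passage_paths_self: "first_passage_paths x x = {[]}"
proof -
  have "zs = []" if "zs \<in> first_passage_paths x x" for zs
    using that by (cases zs) (auto simp: first_passage_paths_def)
  then show ?thesis by (auto simp: first_passage_paths_def)
qed

lemma passage_sum_self: "passage_sum M x x = 1"
  by (simp add: passage_sum_def first_passage_paths_self local_time_weight_def
      nn_integral_count_space_finite)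

text \<open>The two pieces are recovered by cutting at the first visit to \<open>u\<close>.\<close>
lemma inj_on_first_passage_append: "inj_on (\<lambda>(zs, zs'). zs @ zs') (first_passage_paths x u \<times> (first_passage_paths u y))"
proof -
  have *: "takeWhile (\<lambda>z. z \<noteq> u) (zs @ zs') = zs"
    if "zs \<in> first_passage_paths x u" "zs' \<in> first_passage_paths u y" "u \<noteq> y" for zs zs'
  proof -
    have "\<exists>r. zs' = u # r" using that by (cases zs') (auto simp: first_passage_paths_def)
    moreover have "u \<notin> set zs" using that by (auto simp: first_passage_paths_def)
    ultimately show ?thesis by (auto simp: takeWhile_append)
  qed
  show ?thesis
  proof (cases "u = y")
    case True
    then show ?thesis by (auto simp: inj_on_def first_passage_paths_self)
  next
    case False
    show ?thesis
      unfolding inj_on_def using *[OF _ _ False]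
      by (metis (no_types, lifting) SigmaE append_same_eq case_prod_conv same_append_eq)
  qed
qed

section \<open>Path expansion of the travel weight\<close>
lemma measurable_walk [measurable]:
  "(\<lambda>\<xi> k. x + (\<Sum>j<k. \<xi> j)) \<in>
     PiM UNIV (\<lambda>_::nat. measure_pmf (walk_step :: (int ^ 'd::finite) pmf)) \<rightarrow>\<^sub>M PiM UNIV (\<lambda>_. count_space UNIV)"
proof (rule measurable_PiM_single')
  let ?P = "PiM UNIV (\<lambda>_::nat. measure_pmf (walk_step :: (int ^ 'd::finite) pmf))"
  have c: "(\<lambda>\<xi>. \<xi> k) \<in> ?P \<rightarrow>\<^sub>M count_space UNIV" for k
    using measurable_component_singleton[of k UNIV "\<lambda>_. measure_pmf walk_step"] by simp
  show "(\<lambda>\<xi>. x + (\<Sum>j<k. \<xi> j)) \<in> ?P \<rightarrow>\<^sub>M count_space UNIV" for k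
  proof (induction k)
    case (Suc k)
    have "(\<lambda>\<xi>. (\<lambda>i \<xi>. i + \<xi> k) (x + (\<Sum>j<k. \<xi> j)) \<xi>) \<in> ?P \<rightarrow>\<^sub>M count_space UNIV"
    proof (rule measurable_compose_countable[OF _ Suc])
      show "(\<lambda>\<xi>. i + \<xi> k) \<in> ?P \<rightarrow>\<^sub>M count_space UNIV" for i
        using measurable_compose[OF c, of "\<lambda>s. i + s"] by simp
    qed
    then show ?case by (simp add: add.assoc)
  qed simp
qed (simp add: space_PiM)

lemma pmf_walk_step:
  "pmf (walk_step :: (int ^ 'd::finite) pmf) s = (if s \<in> unit_steps then step_prob TYPE('d) else 0)"
  using unit_steps_nonempty[where 'd = 'd] finite_unit_steps[where 'd = 'd]
  by (simp add: walk_step_def step_prob_def flip: unit_steps_def)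

definition cylinder :: "(int ^ 'd) list \<Rightarrow> (nat \<Rightarrow> int ^ 'd) set" where
  "cylinder vs = {S. \<forall>k<length vs. S k = vs ! k}"

lemma cylinder_measurable [measurable]: "cylinder vs \<in> sets (PiM UNIV (\<lambda>_. count_space UNIV))"
proof -
  have "cylinder vs = {S \<in> space (PiM UNIV (\<lambda>_. count_space UNIV)). \<forall>k\<in>{..<length vs}. S k = vs ! k}"
    by (auto simp: cylinder_def space_PiM)
  also have "\<dots> \<in> sets (PiM UNIV (\<lambda>_. count_space UNIV))"
    by measurable
  finally show ?thesis .
qed

lemma walk_eq_iff_steps:
  fixes vs :: "'a::ab_group_add list"
  assumes "length vs = Suc n"
  shows "(\<forall>k<length vs. x + (\<Sum>j<k. \<xi> j) = vs ! k) \<longleftrightarrow>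
    vs ! 0 = x \<and> (\<forall>k<n. \<xi> k = vs ! Suc k - vs ! k)"
proof (intro iffI conjI allI impI)
  assume *: "\<forall>k<length vs. x + (\<Sum>j<k. \<xi> j) = vs ! k"
  from * show "vs ! 0 = x" using assms by auto
  fix k assume "k < n"
  then have "x + (\<Sum>j<Suc k. \<xi> j) = vs ! Suc k" "x + (\<Sum>j<k. \<xi> j) = vs ! k"
    using * assms by (metis Suc_mono less_SucI)+
  then show "\<xi> k = vs ! Suc k - vs ! k" by (metis add.assoc add_diff_cancel_left' sum.lessThan_Suc)
next
  assume *: "vs ! 0 = x \<and> (\<forall>k<n. \<xi> k = vs ! Suc k - vs ! k)"
  fix k assume "k < length vs"
  then show "x + (\<Sum>j<k. \<xi> j) = vs ! k"
  proof (induction k)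
    case (Suc k)
    then show ?case using * assms by (auto simp flip: add.assoc)
  qed (use * in auto)
qed

lemma emeasure_walk_cylinder:
  fixes vs :: "(int ^ 'd::finite) list"
  assumes "vs \<noteq> []"
  shows "emeasure (walk_law x) (cylinder vs) =
    (if hd vs = x \<and> successively adjacent vs then ennreal (step_prob TYPE('d) ^ (length vs - 1)) else 0)"
proof -
  obtain n where n: "length vs = Suc n" using assms by (cases vs) auto
  let ?P = "PiM UNIV (\<lambda>_::nat. measure_pmf (walk_step :: (int ^ 'd::finite) pmf))"
  interpret product_prob_space "\<lambda>_::nat. measure_pmf (walk_step :: (int ^ 'd::finite) pmf)" UNIV
    by unfold_locales
  have succ: "successively adjacent vs \<longleftrightarrow> (\<forall>k<n. adjacent (vs ! k) (vs ! Suc k))"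
    using n by (simp add: successively_conv_nth)
  have "emeasure (walk_law x) (cylinder vs) =
      emeasure ?P {\<xi> \<in> space ?P. \<forall>k<length vs. x + (\<Sum>j<k. \<xi> j) = vs ! k}"
    unfolding walk_law_def
    by (subst emeasure_distr[OF measurable_walk cylinder_measurable])
       (rule arg_cong[where f = "emeasure ?P"], auto simp: cylinder_def)
  also have "\<dots> = emeasure ?P {\<xi> \<in> space ?P. vs ! 0 = x \<and> (\<forall>k\<in>{..<n}. \<xi> k \<in> {vs ! Suc k - vs ! k})}"
    by (simp add: walk_eq_iff_steps[OF n] Ball_def)
  also have "\<dots> = (if hd vs = x \<and> successively adjacent vs then ennreal (step_prob TYPE('d) ^ (length vs - 1)) else 0)"
  proof (cases "vs ! 0 = x")
    case True
    then have "emeasure ?P {\<xi> \<in> space ?P. vs ! 0 = x \<and> (\<forall>k\<in>{..<n}. \<xi> k \<in> {vs ! Suc k - vs ! k})} =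
      (\<Prod>k\<in>{..<n}. emeasure (measure_pmf walk_step) {vs ! Suc k - vs ! k})"
      by (simp only: simp_thms, subst emeasure_PiM_Collect) auto
    also have "\<dots> = (\<Prod>k\<in>{..<n}. ennreal (if adjacent (vs ! k) (vs ! Suc k) then step_prob TYPE('d) else 0))"
      by (simp add: emeasure_pmf_single pmf_walk_step adjacent_def)
    also have "\<dots> = ennreal (\<Prod>k\<in>{..<n}. (if adjacent (vs ! k) (vs ! Suc k) then step_prob TYPE('d) else 0))"
      by (intro prod_ennreal) (simp add: step_prob_pos less_imp_le)
    also have "(\<Prod>k\<in>{..<n}. (if adjacent (vs ! k) (vs ! Suc k) then step_prob TYPE('d) else 0)) =
      (if successively adjacent vs then step_prob TYPE('d) ^ n else 0)"
      by (auto simp: succ)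
    finally show ?thesis using True n assms by (simp add: hd_conv_nth)
  next
    case False
    then show ?thesis using assms by (simp add: hd_conv_nth)
  qed
  finally show ?thesis .
qed

lemma hitting_time_eq_enatI:
  assumes "S n = y" "\<And>k. k < n \<Longrightarrow> S k \<noteq> y"
  shows "hitting_time S y = enat n"
  unfolding hitting_time_def
proof (rule antisym)
  show "(INF k\<in>{k. S k = y}. enat k) \<le> enat n" using assms by (intro INF_lower) simp
  show "enat n \<le> (INF k\<in>{k. S k = y}. enat k)"
    using assms by (intro INF_greatest) (auto simp: not_less[symmetric])
qed

lemma hitting_time_finiteE:
  assumes "hitting_time S y < \<infinity>"
  obtains n where "S n = y" "\<And>k. k < n \<Longrightarrow> S k \<noteq> y"
proof -
  have "\<exists>k. S k = y"
    using assms by (rule_tac ccontr) (auto simp: hitting_time_def top_enat_def)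
  then have "S (LEAST k. S k = y) = y" by (rule LeastI_ex)
  with that not_less_Least show ?thesis by blast
qed

text \<open>At most one summand is nonzero, namely the one of the initial piece of the trajectory up to the
  hitting time; there is none if \<open>y\<close> is never hit.\<close>
lemma travel_integrand_expansion:
  fixes S :: "nat \<Rightarrow> int ^ 'd::finite"
  shows "ennreal (exp (- (\<Sum>k | enat k < hitting_time S y. \<omega> (S k))) * of_bool (hitting_time S y < \<infinity>)) =
   (\<integral>\<^sup>+zs. ennreal (exp (- sum_list (map \<omega> zs))) * indicator (cylinder (zs @ [y])) S
      \<partial>count_space {zs. y \<notin> set zs})"
proof (cases "hitting_time S y < \<infinity>")
  case False
  have "indicator (cylinder (zs @ [y])) S = (0::ennreal)" if "y \<notin> set zs" for zs
  proof (rule ccontr)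
    assume "\<not> ?thesis"
    then have S: "\<forall>k<Suc (length zs). S k = (zs @ [y]) ! k"
      by (auto simp: cylinder_def split: split_indicator_asm)
    have "hitting_time S y = enat (length zs)"
    proof (rule hitting_time_eq_enatI)
      show "S (length zs) = y" using S by auto
      show "S k \<noteq> y" if "k < length zs" for k
        using S that \<open>y \<notin> set zs\<close> by (auto simp: nth_append in_set_conv_nth)
    qed
    then show False using False by simp
  qed
  then have "(\<integral>\<^sup>+zs. ennreal (exp (- sum_list (map \<omega> zs))) * indicator (cylinder (zs @ [y])) S
      \<partial>count_space {zs. y \<notin> set zs}) = (\<integral>\<^sup>+zs. 0 \<partial>count_space {zs. y \<notin> set zs})"
    by (intro nn_integral_cong) auto
  then show ?thesis using False by simp
next
  case True
  then obtain n where n: "S n = y" "\<And>k. k < n \<Longrightarrow> S k \<noteq> y" by (rule hitting_time_finiteE) blast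
  then have H: "hitting_time S y = enat n" by (rule hitting_time_eq_enatI)
  let ?z = "map S [0..<n]"
  let ?f = "\<lambda>zs. ennreal (exp (- sum_list (map \<omega> zs))) * indicator (cylinder (zs @ [y])) S"
  have uniq: "zs = ?z" if "y \<notin> set zs" "S \<in> cylinder (zs @ [y])" for zs
  proof -
    have S: "\<forall>k<Suc (length zs). S k = (zs @ [y]) ! k"
      using that by (auto simp: cylinder_def)
    have "hitting_time S y = enat (length zs)"
    proof (rule hitting_time_eq_enatI)
      show "S (length zs) = y" using S by auto
      show "S k \<noteq> y" if "k < length zs" for k
        using S that \<open>y \<notin> set zs\<close> by (auto simp: nth_append in_set_conv_nth)
    qed
    with H have "length zs = n" by simp
    then show ?thesis using S by (auto intro!: nth_equalityI simp: nth_append)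
  qed
  have mem: "S \<in> cylinder (?z @ [y])" "y \<notin> set ?z"
  proof -
    show "S \<in> cylinder (?z @ [y])"
      using n(1) by (auto simp: cylinder_def nth_append less_Suc_eq)
    show "y \<notin> set ?z"
    proof
      assume "y \<in> set ?z"
      then obtain k where "k < n" "S k = y" by auto
      then show False using n(2) by blast
    qed
  qed
  have "(\<integral>\<^sup>+zs. ?f zs \<partial>count_space {zs. y \<notin> set zs}) = (\<Sum>zs\<in>{?z}. ?f zs)"
    using mem uniq by (intro nn_integral_count_space') (auto split: split_indicator)
  also have "\<dots> = ennreal (exp (- (\<Sum>k<n. \<omega> (S k))))"
    using mem by (simp add: comp_def interv_sum_list_conv_sum_set_nat atLeast0LessThan)
  finally show ?thesis using H by (simp add: lessThan_def)
qed

lemma emeasure_walk_first_passage: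
  fixes zs :: "(int ^ 'd::finite) list"
  assumes "y \<notin> set zs"
  shows "emeasure (walk_law x) (cylinder (zs @ [y])) =
    (if zs \<in> first_passage_paths x y then ennreal (step_probability zs) else 0)"
  using assms by (auto simp: emeasure_walk_cylinder first_passage_paths_def)

lemma nn_integral_walk_first_passage:
  fixes x y :: "int ^ 'd::finite"
  shows "(\<integral>\<^sup>+zs. w zs * emeasure (walk_law x) (cylinder (zs @ [y])) \<partial>count_space {zs. y \<notin> set zs}) =
    (\<integral>\<^sup>+zs. w zs * ennreal (step_probability zs) \<partial>count_space (first_passage_paths x y))"
proof -
  have "(\<integral>\<^sup>+zs. w zs * emeasure (walk_law x) (cylinder (zs @ [y])) \<partial>count_space {zs. y \<notin> set zs}) =
     (\<integral>\<^sup>+zs. w zs * emeasure (walk_law x) (cylinder (zs @ [y])) \<partial>count_space (first_passage_paths x y))"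
    by (rule nn_integral_count_space_eq) (auto simp: emeasure_walk_first_passage first_passage_paths_def)
  also have "\<dots> = (\<integral>\<^sup>+zs. w zs * ennreal (step_probability zs) \<partial>count_space (first_passage_paths x y))"
    by (rule nn_integral_cong) (simp add: emeasure_walk_first_passage first_passage_paths_def)
  finally show ?thesis .
qed

lemma borel_measurable_nn_integral_countable:
  assumes "countable A" "\<And>i. i \<in> A \<Longrightarrow> f i \<in> borel_measurable N"
  shows "(\<lambda>x. \<integral>\<^sup>+i. f i x \<partial>count_space A) \<in> borel_measurable N"
proof -
  interpret sigma_finite_measure "count_space A"
    using assms(1) by (rule sigma_finite_measure_count_space_countable)
  have "(\<lambda>(i, x). f i x) \<in> borel_measurable (count_space A \<Otimes>\<^sub>M N)"
    using assms by (intro measurable_pair_measure_countable1) auto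
  then have "(\<lambda>(x, i). f i x) \<in> borel_measurable (N \<Otimes>\<^sub>M count_space A)"
    by (subst (asm) measurable_pair_swap_iff) simp
  then show ?thesis by (rule borel_measurable_nn_integral)
qed

text \<open>The identity holds for every \<open>\<omega>\<close>, including those with negative values for which the expectation
  may be infinite: the Bochner integral and \<^const>\<open>enn2real\<close> then both yield \<open>0\<close>.\<close>
lemma travel_weight_expansion:
  fixes x y :: "int ^ 'd::finite"
  shows "travel_weight x y \<omega> = enn2real
    (\<integral>\<^sup>+zs. ennreal (exp (- sum_list (map \<omega> zs))) * ennreal (step_probability zs)
       \<partial>count_space (first_passage_paths x y))"
proof -
  let ?h = "\<lambda>S. exp (- (\<Sum>k | enat k < hitting_time S y. \<omega> (S k))) * of_bool (hitting_time S y < \<infinity>)"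
  let ?w = "\<lambda>zs::(int^'d) list. ennreal (exp (- sum_list (map \<omega> zs)))"
  let ?A = "{zs::(int^'d) list. y \<notin> set zs}"
  have sets: "sets (walk_law x) = sets (PiM UNIV (\<lambda>_. count_space UNIV))"
    by (simp add: walk_law_def)
  have [measurable]: "cylinder vs \<in> sets (walk_law x)" for vs by (simp add: sets)
  have m: "(\<lambda>S. ennreal (?h S)) \<in> borel_measurable (walk_law x)"
    unfolding travel_integrand_expansion
    by (rule borel_measurable_nn_integral_countable) (simp, measurable)
  then have meas: "(\<lambda>S. ?h S) \<in> borel_measurable (walk_law x)"
  proof -
    have "(\<lambda>S. enn2real (ennreal (?h S))) \<in> borel_measurable (walk_law x)"
      using m by measurable
    then show ?thesis by simp
  qed
  have "travel_weight x y \<omega> = enn2real (\<integral>\<^sup>+S. ennreal (?h S) \<partial>walk_law x)"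
    unfolding travel_weight_def using meas by (intro integral_eq_nn_integral) auto
  also have "(\<integral>\<^sup>+S. ennreal (?h S) \<partial>walk_law x) =
      (\<integral>\<^sup>+S. (\<integral>\<^sup>+zs. ?w zs * indicator (cylinder (zs @ [y])) S \<partial>count_space ?A) \<partial>walk_law x)"
    by (simp only: travel_integrand_expansion)
  also have "\<dots> = (\<integral>\<^sup>+zs. (\<integral>\<^sup>+S. ?w zs * indicator (cylinder (zs @ [y])) S \<partial>walk_law x) \<partial>count_space ?A)"
    by (intro nn_integral_count_space_nn_integral) auto
  also have "\<dots> = (\<integral>\<^sup>+zs. ?w zs * emeasure (walk_law x) (cylinder (zs @ [y])) \<partial>count_space ?A)"
    by (intro nn_integral_cong) (simp add: nn_integral_cmult)
  also have "\<dots> = (\<integral>\<^sup>+zs. ?w zs * ennreal (step_probability zs) \<partial>count_space (first_passage_paths x y))"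
    by (rule nn_integral_walk_first_passage)
  finally show ?thesis .
qed

text \<open>The left-hand side is the probability that the walk ever hits \<open>y\<close>.\<close>
lemma passage_probability_le_one:
  fixes x y :: "int ^ 'd::finite"
  shows
  "(\<integral>\<^sup>+zs. ennreal (step_probability zs) \<partial>count_space (first_passage_paths x y)) \<le> 1"
proof -
  interpret prob_space "walk_law x"
    unfolding walk_law_def
    by (intro prob_space.prob_space_distr measurable_walk prob_space_PiM) (simp add: measure_pmf.prob_space_axioms)
  let ?A = "{zs. y \<notin> set zs}"
  have [measurable]: "cylinder vs \<in> sets (walk_law x)" for vs by (simp add: walk_law_def)
  have "(\<integral>\<^sup>+zs. ennreal (step_probability zs) \<partial>count_space (first_passage_paths x y)) =
     (\<integral>\<^sup>+zs. emeasure (walk_law x) (cylinder (zs @ [y])) \<partial>count_space ?A)"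
    using nn_integral_walk_first_passage[where w = "\<lambda>_. 1" and x = x and y = y] by simp
  also have "\<dots> = (\<integral>\<^sup>+S. (\<integral>\<^sup>+zs. indicator (cylinder (zs @ [y])) S \<partial>count_space ?A) \<partial>walk_law x)"
    by (subst nn_integral_count_space_nn_integral) auto
  also have "\<dots> \<le> (\<integral>\<^sup>+S. 1 \<partial>walk_law x)"
  proof (intro nn_integral_mono)
    fix S
    show "(\<integral>\<^sup>+zs. indicator (cylinder (zs @ [y])) S \<partial>count_space ?A) \<le> 1"
      using travel_integrand_expansion[where S = S and y = y and \<omega> = "\<lambda>_. 0", symmetric] by simp
  qed
  also have "\<dots> = 1" by (simp add: emeasure_space_1)
  finally show ?thesis .
qed

section \<open>Supermultiplicativity and symmetries of passage sums\<close>
lemma first_passage_split_at_target: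
  assumes "zs \<in> first_passage_paths x u" "y \<in> set zs"
  shows "takeWhile (\<lambda>z. z \<noteq> y) zs \<in> first_passage_paths x y"
    and "dropWhile (\<lambda>z. z \<noteq> y) zs \<in> first_passage_paths y u"
proof -
  obtain a b where zs: "zs = a @ y # b" "y \<notin> set a"
    using split_list_first[OF assms(2)] by blast
  have a: "takeWhile (\<lambda>z. z \<noteq> y) zs = a" and b: "dropWhile (\<lambda>z. z \<noteq> y) zs = y # b"
    using zs(2) unfolding zs(1) by (subst takeWhile_append2 dropWhile_append2; force)+
  have *: "successively adjacent (a @ [y])" "successively adjacent ((y # b) @ [u])" "hd (a @ y # b @ [u]) = x" "u \<notin> set (a @ y # b)"
  proof -
    have "successively adjacent ((a @ [y]) @ (b @ [u]))" "successively adjacent (a @ ((y # b) @ [u]))"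
      "hd (a @ y # b @ [u]) = x" "u \<notin> set (a @ y # b)"
      using assms(1) by (auto simp: first_passage_paths_def zs(1))
    then show "successively adjacent (a @ [y])" "successively adjacent ((y # b) @ [u])"
      "hd (a @ y # b @ [u]) = x" "u \<notin> set (a @ y # b)"
      by (simp_all only: successively_append_iff) auto
  qed
  show "takeWhile (\<lambda>z. z \<noteq> y) zs \<in> first_passage_paths x y"
    unfolding a using * zs(2) by (auto simp: first_passage_paths_def successively_append_iff hd_append)
  show "dropWhile (\<lambda>z. z \<noteq> y) zs \<in> first_passage_paths y u"
    unfolding b using * by (simp add: first_passage_paths_def)
qed

lemma first_passage_append:
  assumes "zs \<in> first_passage_paths x u" "zs' \<in> first_passage_paths u y" "y \<notin> set zs"
  shows "zs @ zs' \<in> first_passage_paths x y"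
  using assms
  by (cases zs'; cases zs) (auto simp: first_passage_paths_def successively_append_iff hd_append
      successively_Cons split: if_splits)

context laplace_sequence
begin

lemma passage_sum_le_one: "passage_sum M x y \<le> 1"
proof -
  have "passage_sum M x y \<le> (\<integral>\<^sup>+zs. ennreal (step_probability zs) \<partial>count_space (first_passage_paths x y))"
    unfolding passage_sum_def
    using local_time_weight_le_one step_prob_pos[where 'd = 'a]
    by (intro nn_integral_mono ennreal_leI) (auto intro!: mult_left_le)
  also have "\<dots> \<le> 1" by (rule passage_probability_le_one)
  finally show ?thesis .
qed

text \<open>Concatenating a path from \<open>x\<close> to \<open>u\<close> with one from \<open>u\<close> to \<open>y\<close> gives a first passage path to \<open>y\<close>
  through \<open>u\<close>, unless the first piece already hits \<open>y\<close>.  In that case the piece is cut at its first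
  visit to \<open>y\<close>, which leaves a first passage path to \<open>y\<close> that avoids \<open>u\<close>; what is cut off is only
  weighted by step probabilities, and these add up to at most \<open>1\<close>.  Both cases together use every
  path from \<open>x\<close> to \<open>y\<close> at most once.\<close>
lemma passage_sum_supermultiplicative:
  fixes x u y :: "int ^ 'd::finite"
  shows "passage_sum M x u * passage_sum M u y \<le> passage_sum M x y"
proof (cases "u = y")
  case True
  then show ?thesis by (simp add: passage_sum_self)
next
  case False
  define w where "w zs = ennreal (step_probability zs * local_time_weight M zs)" for zs :: "(int ^ 'd) list"
  define p where "p zs = ennreal (step_probability zs)" for zs :: "(int ^ 'd) list"
  let ?P = "first_passage_paths :: int ^ 'd \<Rightarrow> _"
  let ?avoid = "{zs \<in> ?P x u. y \<notin> set zs}" and ?hit = "{zs \<in> ?P x u. y \<in> set zs}"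
  let ?via = "{zs \<in> ?P x y. u \<in> set zs}" and ?notvia = "{zs \<in> ?P x y. u \<notin> set zs}"
  note q = step_prob_pos[where 'd = 'd, THEN less_imp_le]
  have ps: "passage_sum M a b = (\<integral>\<^sup>+zs. w zs \<partial>count_space (?P a b))" for a b
    by (simp only: passage_sum_def w_def)
  have times_rearrange: "(r * s) * t = (r * t) * s" for r s t :: real by simp
  have split: "(\<integral>\<^sup>+zs. f zs \<partial>count_space {zs \<in> A. Q zs}) + (\<integral>\<^sup>+zs. f zs \<partial>count_space {zs \<in> A. \<not> Q zs}) =
      (\<integral>\<^sup>+zs. f zs \<partial>count_space A)" for f :: "_ \<Rightarrow> ennreal" and A and Q :: "(int^'d) list \<Rightarrow> bool"
    by (subst (1 2 3) nn_integral_count_space_indicator, simp, simp, simp, subst nn_integral_add[symmetric])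
       (auto intro!: nn_integral_cong split: split_indicator)
  have p_le: "(\<integral>\<^sup>+zs. p zs \<partial>count_space (?P a b)) \<le> 1" for a b
    unfolding p_def by (rule passage_probability_le_one)
  have "(\<integral>\<^sup>+zs. w zs \<partial>count_space ?avoid) * passage_sum M u y =
      (\<integral>\<^sup>+zs. \<integral>\<^sup>+zs'. w zs * w zs' \<partial>count_space (?P u y) \<partial>count_space ?avoid)"
    by (simp add: passage_sum_def w_def[symmetric] nn_integral_cmult nn_integral_multc)
  also have "\<dots> = (\<integral>\<^sup>+(zs, zs'). w zs * w zs' \<partial>count_space (?avoid \<times> ?P u y))"
    by (rule nn_integral_count_space_Sigma)
  also have "\<dots> \<le> (\<integral>\<^sup>+zz. w ((\<lambda>(zs, zs'). zs @ zs') zz) \<partial>count_space (?avoid \<times> ?P u y))"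
  proof (intro nn_integral_mono, clarsimp)
    fix zs zs' :: "(int ^ 'd) list"
    have "step_probability zs * step_probability zs' * (local_time_weight M zs * local_time_weight M zs')
        \<le> step_probability zs * step_probability zs' * local_time_weight M (zs @ zs')"
      by (intro mult_left_mono local_time_weight_append_ge) (simp add: q)
    then show "w zs * w zs' \<le> w (zs @ zs')"
      unfolding w_def using q local_time_weight_pos[THEN less_imp_le]
      by (subst ennreal_mult'[symmetric])
         (auto simp: power_add mult_ac less_imp_le intro!: ennreal_leI mult_nonneg_nonneg)
  qed
  also have "\<dots> \<le> (\<integral>\<^sup>+zs. w zs \<partial>count_space ?via)"
  proof (rule nn_integral_count_space_inj_le)
    show "inj_on (\<lambda>(zs, zs'). zs @ zs') (?avoid \<times> ?P u y)"
      using inj_on_first_passage_append[of x u y] by (rule inj_on_subset) auto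
    have "u \<in> set zs'" if "zs' \<in> ?P u y" for zs'
      using that False by (cases zs') (auto simp: first_passage_paths_def)
    then show "(\<lambda>(zs, zs'). zs @ zs') ` (?avoid \<times> ?P u y) \<subseteq> ?via"
      by (auto intro: first_passage_append)
  qed
  finally have avoid: "(\<integral>\<^sup>+zs. w zs \<partial>count_space ?avoid) * passage_sum M u y \<le> (\<integral>\<^sup>+zs. w zs \<partial>count_space ?via)" .

  let ?a = "takeWhile (\<lambda>z. z \<noteq> y)" and ?b = "dropWhile (\<lambda>z. z \<noteq> y)"
  have "(\<integral>\<^sup>+zs. w zs \<partial>count_space ?hit) \<le>
     (\<integral>\<^sup>+zs. (case (?a zs, ?b zs) of (a, b) \<Rightarrow> w a * p b) \<partial>count_space ?hit)"
  proof (intro nn_integral_mono)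
    fix zs :: "(int ^ 'd) list"
    have len: "length zs = length (?a zs) + length (?b zs)"
      using length_append[of "?a zs" "?b zs"] by (simp only: takeWhile_dropWhile_id)
    have "local_time_weight M zs \<le> local_time_weight M (?a zs)"
      using local_time_weight_append_le[of "?a zs" "?b zs"] by (simp only: takeWhile_dropWhile_id)
    then have "step_probability zs * local_time_weight M zs \<le>
        step_probability zs * local_time_weight M (?a zs)"
      by (rule mult_left_mono) (simp add: q)
    also have "\<dots> = (step_probability (?a zs) * local_time_weight M (?a zs)) * step_probability (?b zs)"
      by (subst len, subst power_add) (rule times_rearrange)
    finally have "w zs \<le> ennreal ((step_probability (?a zs) * local_time_weight M (?a zs)) * step_probability (?b zs))"
      unfolding w_def by (rule ennreal_leI)
    also have "\<dots> = w (?a zs) * p (?b zs)"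
      unfolding w_def p_def by (rule ennreal_mult'') (simp add: q)
    finally show "w zs \<le> (case (?a zs, ?b zs) of (a, b) \<Rightarrow> w a * p b)"
      unfolding prod.case .
  qed
  also have "\<dots> \<le> (\<integral>\<^sup>+(a, b). w a * p b \<partial>count_space (?notvia \<times> ?P y u))"
  proof (rule nn_integral_count_space_inj_le)
    show "inj_on (\<lambda>zs. (?a zs, ?b zs)) ?hit"
    proof (rule inj_onI)
      fix zs zs' :: "(int ^ 'd) list" assume "(?a zs, ?b zs) = (?a zs', ?b zs')"
      then have "?a zs @ ?b zs = ?a zs' @ ?b zs'" by (simp only: prod.inject)
      then show "zs = zs'" by (simp only: takeWhile_dropWhile_id)
    qed
    show "(\<lambda>zs. (?a zs, ?b zs)) ` ?hit \<subseteq> ?notvia \<times> ?P y u"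
    proof (rule image_subsetI)
      fix zs assume "zs \<in> ?hit"
      then have zs: "zs \<in> ?P x u" "y \<in> set zs" by auto
      have "u \<notin> set (?a zs)"
        using zs(1) by (auto simp: first_passage_paths_def dest: set_takeWhileD)
      then show "(?a zs, ?b zs) \<in> ?notvia \<times> ?P y u"
        using first_passage_split_at_target[OF zs] by simp
    qed
  qed
  also have "\<dots> = (\<integral>\<^sup>+a. w a \<partial>count_space ?notvia) * (\<integral>\<^sup>+b. p b \<partial>count_space (?P y u))"
    by (simp add: nn_integral_count_space_Sigma[symmetric] nn_integral_cmult nn_integral_multc)
  also have "\<dots> \<le> (\<integral>\<^sup>+a. w a \<partial>count_space ?notvia) * 1"
    by (intro mult_left_mono p_le) auto
  finally have "(\<integral>\<^sup>+zs. w zs \<partial>count_space ?hit) * passage_sum M u y \<le> (\<integral>\<^sup>+a. w a \<partial>count_space ?notvia) * 1"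
    by (intro mult_mono passage_sum_le_one) auto
  with avoid have "((\<integral>\<^sup>+zs. w zs \<partial>count_space ?hit) + (\<integral>\<^sup>+zs. w zs \<partial>count_space ?avoid)) * passage_sum M u y
     \<le> (\<integral>\<^sup>+zs. w zs \<partial>count_space ?via) + (\<integral>\<^sup>+a. w a \<partial>count_space ?notvia)"
    unfolding distrib_right by (subst (2) add.commute) (intro add_mono, auto)
  then show ?thesis
    unfolding split by (simp only: ps)
qed

lemma passage_sum_adjacent:
  fixes x y :: "int ^ 'd::finite"
  assumes "adjacent x y"
  shows "ennreal (step_prob TYPE('d) * M 1) \<le> passage_sum M x y"
proof -
  have "[x] \<in> first_passage_paths x y"
    using assms not_adjacent_self by (auto simp: first_passage_paths_def)
  from nn_integral_ge_point[OF this, of "\<lambda>zs. ennreal (step_probability zs * local_time_weight M zs)"]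
  show ?thesis by (simp add: passage_sum_def local_time_weight_def)
qed

end

lemma local_time_weight_map:
  assumes "inj h"
  shows "local_time_weight M (map h zs) = local_time_weight M zs"
  unfolding local_time_weight_def
  using assms by (simp add: prod.reindex inj_on_subset[OF assms] count_list_map_conv)

text \<open>Applied to a bijection and its inverse, this gives invariance of passage sums under translations
  and under the reflection at the origin.\<close>
lemma passage_sum_symmetry_le:
  fixes h :: "int ^ 'd::finite \<Rightarrow> int ^ 'd"
  assumes "inj h" "\<And>v w. adjacent v w \<Longrightarrow> adjacent (h v) (h w)"
  shows "passage_sum M x y \<le> passage_sum M (h x) (h y)"
proof -
  have "passage_sum M x y = (\<integral>\<^sup>+zs. ennreal (step_probability (map h zs) * local_time_weight M (map h zs))
        \<partial>count_space (first_passage_paths x y))"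
    by (simp add: passage_sum_def local_time_weight_map assms(1))
  also have "\<dots> \<le> passage_sum M (h x) (h y)"
    unfolding passage_sum_def
  proof (rule nn_integral_count_space_inj_le)
    show "inj_on (map h) (first_passage_paths x y)"
      using assms(1) by (meson inj_mapI inj_on_subset subset_UNIV)
    show "map h ` first_passage_paths x y \<subseteq> first_passage_paths (h x) (h y)"
    proof (clarsimp simp: first_passage_paths_def inj_image_mem_iff[OF assms(1)])
      fix zs assume "successively adjacent (zs @ [y])"
      then have "successively adjacent (map h (zs @ [y]))"
        unfolding successively_map by (rule successively_mono) (use assms(2) in auto)
      moreover have "hd (map h zs @ [h y]) = h (hd (zs @ [y]))" by (cases zs) auto
      ultimately show "successively adjacent (map h zs @ [h y]) \<and> hd (map h zs @ [h y]) = h (hd (zs @ [y]))"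
        by simp
    qed
  qed
  finally show ?thesis .
qed

lemma passage_sum_translate: "passage_sum M (v + x) (v + y) = passage_sum M x y"
proof (rule antisym)
  show "passage_sum M x y \<le> passage_sum M (v + x) (v + y)"
    by (rule passage_sum_symmetry_le) (auto simp: adjacent_def)
  show "passage_sum M (v + x) (v + y) \<le> passage_sum M x y"
    using passage_sum_symmetry_le[of "\<lambda>z. - v + z" M "v + x" "v + y"] by (auto simp: adjacent_def)
qed

lemma passage_sum_uminus: "passage_sum M (- x) (- y) = passage_sum M x y"
proof -
  have *: "adjacent (- v) (- w)" if "adjacent v w" for v w :: "int ^ 'a"
    using that uminus_unit_steps_iff[of "w - v"] by (simp add: adjacent_def)
  show ?thesis
    using passage_sum_symmetry_le[of uminus M x y] passage_sum_symmetry_le[of uminus M "- x" "- y"] *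
    by (auto intro: antisym)
qed

section \<open>Integrating out the potential\<close>
definition laplace_transform :: "(real \<Rightarrow> real) \<Rightarrow> nat \<Rightarrow> real" where
  "laplace_transform \<phi> k = (\<integral>t. exp (- (real k * t)) \<partial>interval_measure \<phi>)"

lemma nonneg_distribution_function_at_bot:
  "nonneg_distribution_function \<phi> \<Longrightarrow> (\<phi> \<longlongrightarrow> 0) at_bot"
  unfolding nonneg_distribution_function_def
  by (intro tendsto_eventually) (auto simp: eventually_at_bot_linorder intro!: exI[of _ "- 1"])

lemma emeasure_interval_measure_atMost:
  assumes "nonneg_distribution_function \<phi>"
  shows "emeasure (interval_measure \<phi>) {..t} = ennreal (\<phi> t)"
  using assms nonneg_distribution_function_at_bot[OF assms]
  by (intro emeasure_interval_measure_Iic) (auto simp: nonneg_distribution_function_def mono_def)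

lemma prob_space_interval_measure:
  assumes "nonneg_distribution_function \<phi>"
  shows "prob_space (interval_measure \<phi>)"
proof -
  have "real_distribution (interval_measure \<phi>)"
    using assms nonneg_distribution_function_at_bot[OF assms]
    by (intro real_distribution_interval_measure) (auto simp: nonneg_distribution_function_def mono_def)
  then show ?thesis by (rule real_distribution.axioms)
qed

lemma AE_interval_measure_nonneg:
  assumes "nonneg_distribution_function \<phi>"
  shows "AE t in interval_measure \<phi>. 0 \<le> t"
proof -
  have "AE t in interval_measure \<phi>. - (1 / Suc n) < t" for n
  proof (rule AE_I)
    show "{t \<in> space (interval_measure \<phi>). \<not> - (1 / Suc n) < t} \<subseteq> {..- (1 / Suc n)}" by auto
    have "\<phi> (- (1 / Suc n)) = 0" using assms by (auto simp: nonneg_distribution_function_def)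
    then show "emeasure (interval_measure \<phi>) {..- (1 / Suc n)} = 0"
      by (simp add: emeasure_interval_measure_atMost[OF assms])
  qed simp
  then have "AE t in interval_measure \<phi>. \<forall>n::nat. - (1 / Suc n) < t" by (simp add: AE_all_countable)
  then show ?thesis
  proof (rule eventually_mono)
    fix t assume *: "\<forall>n::nat. - (1 / Suc n) < t"
    show "0 \<le> t"
    proof (rule ccontr)
      assume "\<not> 0 \<le> t"
      then obtain n where "inverse (real (Suc n)) < - t"
        using reals_Archimedean[of "- t"] by auto
      with *[rule_format, of n] show False by (simp add: inverse_eq_divide)
    qed
  qed
qed

lemma integrable_laplace:
  assumes "nonneg_distribution_function \<phi>"
  shows "integrable (interval_measure \<phi>) (\<lambda>t. exp (- (real k * t)))"
proof -
  interpret prob_space "interval_measure \<phi>" by (rule prob_space_interval_measure[OF assms])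
  show ?thesis
    using AE_interval_measure_nonneg[OF assms]
    by (intro integrable_const_bound[where B = 1]) (auto elim!: eventually_mono)
qed

text \<open>The supermultiplicativity is Chebyshev's association inequality for the decreasing functions
  \<open>e\<^sup>-\<^sup>k\<^sup>t\<close> and \<open>e\<^sup>-\<^sup>l\<^sup>t\<close>.\<close>
lemma laplace_sequence_laplace_transform:
  assumes "nonneg_distribution_function \<phi>"
  shows "laplace_sequence (laplace_transform \<phi>)"
proof
  interpret prob_space "interval_measure \<phi>" by (rule prob_space_interval_measure[OF assms])
  note int [simp] = integrable_laplace[OF assms]
  let ?L = "laplace_transform \<phi>"
  show "?L 0 = 1" by (simp add: laplace_transform_def prob_space[simplified])
  show pos: "0 < ?L k" for k
  proof -
    have "\<not> (AE t in interval_measure \<phi>. exp (- (real k * t)) = 0)"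
      using AE_False by simp
    then have "?L k \<noteq> 0"
      unfolding laplace_transform_def by (subst integral_nonneg_eq_0_iff_AE) auto
    moreover have "0 \<le> ?L k" by (simp add: laplace_transform_def)
    ultimately show ?thesis by simp
  qed
  show "?L l \<le> ?L k" if "k \<le> l" for k l
    unfolding laplace_transform_def
    using AE_interval_measure_nonneg[OF assms] that
    by (intro integral_mono_AE) (auto elim!: eventually_mono intro!: mult_right_mono)
  show "?L k * ?L l \<le> ?L (k + l)" for k l
  proof (cases "k = 0")
    case True
    then show ?thesis by (simp add: laplace_transform_def prob_space[simplified])
  next
    case False
    \<comment> \<open>The point at which \<open>e\<^sup>-\<^sup>k\<^sup>t\<close> takes its mean value: both factors below change sign there.\<close>
    define c where "c = - ln (?L k) / k"
    have c: "exp (- (real k * c)) = ?L k"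
      using False pos[of k] by (simp add: c_def)
    have "0 \<le> (exp (- (real k * t)) - ?L k) * (exp (- (real l * t)) - exp (- (real l * c)))" for t
    proof (cases "t \<le> c")
      case True
      then show ?thesis unfolding c[symmetric] by (intro mult_nonneg_nonneg) (auto intro: mult_left_mono)
    next
      case False
      then show ?thesis unfolding c[symmetric] by (intro mult_nonpos_nonpos) (auto intro: mult_left_mono)
    qed
    then have "0 \<le> (\<integral>t. (exp (- (real k * t)) - ?L k) * (exp (- (real l * t)) - exp (- (real l * c))) \<partial>interval_measure \<phi>)"
      by simp
    also have "\<dots> = (\<integral>t. exp (- (real (k + l) * t)) - ?L k * exp (- (real l * t))
        - exp (- (real l * c)) * exp (- (real k * t)) + ?L k * exp (- (real l * c)) \<partial>interval_measure \<phi>)"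
      by (intro Bochner_Integration.integral_cong) (auto simp: algebra_simps mult_exp_exp)
    also have "\<dots> = ?L (k + l) - ?L k * ?L l"
      using int[of k] int[of l] int[of "k + l"]
      by (simp add: laplace_transform_def prob_space[simplified] del: of_nat_add)
    finally show ?thesis by simp
  qed
qed

lemma nn_integral_laplace:
  assumes "nonneg_distribution_function \<phi>"
  shows "(\<integral>\<^sup>+t. ennreal (exp (- (real k * t))) \<partial>interval_measure \<phi>) = ennreal (laplace_transform \<phi> k)"
  unfolding laplace_transform_def
  by (intro nn_integral_eq_integral integrable_laplace[OF assms]) simp

lemma sum_list_map_eq_sum_local_time:
  fixes \<omega> :: "'a \<Rightarrow> real"
  assumes "finite S" "set zs \<subseteq> S"
  shows "sum_list (map \<omega> zs) = (\<Sum>z\<in>S. real (count_list zs z) * \<omega> z)"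
  using assms(2)
proof (induction zs)
  case (Cons a zs)
  have "(\<Sum>z\<in>S. real (count_list (a # zs) z) * \<omega> z) =
      (\<Sum>z\<in>S. real (count_list zs z) * \<omega> z + (if z = a then \<omega> z else 0))"
    by (intro sum.cong) (auto simp: algebra_simps)
  with Cons assms(1) show ?case by (simp add: sum.distrib)
qed simp

lemma nn_integral_PiM_prod:
  assumes "\<And>i. prob_space (N i)" "finite J" "\<And>i. i \<in> J \<Longrightarrow> f i \<in> borel_measurable (N i)"
  shows "(\<integral>\<^sup>+\<omega>. (\<Prod>i\<in>J. f i (\<omega> i)) \<partial>PiM UNIV N) = (\<Prod>i\<in>J. \<integral>\<^sup>+t. f i t \<partial>N i)"
proof -
  interpret prob_space "N i" for i by (rule assms)
  interpret product_prob_space N UNIV by unfold_locales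
  note [measurable] = assms(3)
  have "(\<integral>\<^sup>+\<omega>. (\<Prod>i\<in>J. f i (\<omega> i)) \<partial>PiM UNIV N) =
      (\<integral>\<^sup>+\<omega>. (\<Prod>i\<in>J. f i (restrict \<omega> J i)) \<partial>PiM UNIV N)"
    by simp
  also have "\<dots> = (\<integral>\<^sup>+\<omega>. (\<Prod>i\<in>J. f i (\<omega> i)) \<partial>PiM J N)"
    using assms(2,3)
    by (subst distr_PiM_restrict_finite[of J, symmetric], simp, simp, subst nn_integral_distr)
       (auto intro!: borel_measurable_prod_ennreal measurable_restrict_subset
         measurable_compose[OF measurable_component_singleton])
  also have "\<dots> = (\<Prod>i\<in>J. \<integral>\<^sup>+t. f i t \<partial>N i)"
    using assms by (intro product_nn_integral_prod) auto
  finally show ?thesis .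
qed

text \<open>By independence, the mean of \<open>e\<close> to minus the sum of the potential along a path is a product over
  the visited sites.\<close>
lemma annealed_travel_weight:
  fixes x y :: "int ^ 'd::finite"
  assumes "nonneg_distribution_function \<phi>"
  shows "(\<integral>\<omega>. travel_weight x y \<omega> \<partial>potential_law \<phi>) =
    enn2real (passage_sum (laplace_transform \<phi>) x y)"
proof -
  let ?P = "potential_law \<phi> :: (int ^ 'd \<Rightarrow> real) measure"
  let ?e = "\<lambda>\<omega>. (\<integral>\<^sup>+zs. ennreal (exp (- sum_list (map \<omega> zs))) * ennreal (step_probability zs)
       \<partial>count_space (first_passage_paths x y))"
  have ps: "prob_space (interval_measure \<phi>)" by (rule prob_space_interval_measure[OF assms])
  have comp: "(\<lambda>\<omega>. \<omega> z) \<in> borel_measurable ?P" for z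
    using measurable_component_singleton[of z UNIV "\<lambda>_. interval_measure \<phi>"]
    by (simp add: potential_law_def cong: measurable_cong_sets)
  have meas_sum: "(\<lambda>\<omega>. sum_list (map \<omega> zs)) \<in> borel_measurable ?P" for zs
    using comp by (induction zs) auto
  have meas: "?e \<in> borel_measurable ?P"
    using meas_sum by (intro borel_measurable_nn_integral_countable) auto
  have "AE \<omega> in ?P. \<forall>z. 0 \<le> \<omega> z"
    unfolding potential_law_def AE_all_countable
    using ps AE_interval_measure_nonneg[OF assms] by (auto intro!: AE_PiM_component)
  then have fin: "AE \<omega> in ?P. ennreal (enn2real (?e \<omega>)) = ?e \<omega>"
  proof (rule eventually_mono)
    fix \<omega> :: "int ^ 'd \<Rightarrow> real" assume nonneg: "\<forall>z. 0 \<le> \<omega> z"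
    have "?e \<omega> \<le> (\<integral>\<^sup>+zs. ennreal (step_probability zs) \<partial>count_space (first_passage_paths x y))"
    proof (rule nn_integral_mono)
      fix zs :: "(int ^ 'd) list"
      have "0 \<le> sum_list (map \<omega> zs)" using nonneg by (intro sum_list_nonneg) auto
      then have "ennreal (exp (- sum_list (map \<omega> zs))) \<le> 1" by simp
      then show "ennreal (exp (- sum_list (map \<omega> zs))) * ennreal (step_probability zs) \<le> ennreal (step_probability zs)"
        using mult_right_mono[of "ennreal (exp (- sum_list (map \<omega> zs)))" 1 "ennreal (step_probability zs)"] by simp
    qed
    also have "\<dots> \<le> 1" by (rule passage_probability_le_one)
    also have "\<dots> < \<top>" by simp
    finally show "ennreal (enn2real (?e \<omega>)) = ?e \<omega>" by simp
  qed
  have "(\<integral>\<omega>. travel_weight x y \<omega> \<partial>?P) = (\<integral>\<omega>. enn2real (?e \<omega>) \<partial>?P)"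
    by (simp add: travel_weight_expansion)
  also have "\<dots> = enn2real (\<integral>\<^sup>+\<omega>. ennreal (enn2real (?e \<omega>)) \<partial>?P)"
    using meas by (intro integral_eq_nn_integral) auto
  also have "(\<integral>\<^sup>+\<omega>. ennreal (enn2real (?e \<omega>)) \<partial>?P) = (\<integral>\<^sup>+\<omega>. ?e \<omega> \<partial>?P)"
    by (rule nn_integral_cong_AE[OF fin])
  also have "\<dots> = (\<integral>\<^sup>+zs. (\<integral>\<^sup>+\<omega>. ennreal (exp (- sum_list (map \<omega> zs))) * ennreal (step_probability zs) \<partial>?P)
       \<partial>count_space (first_passage_paths x y))"
    using meas_sum by (intro nn_integral_count_space_nn_integral) auto
  also have "\<dots> = passage_sum (laplace_transform \<phi>) x y"
    unfolding passage_sum_def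
  proof (rule nn_integral_cong)
    fix zs :: "(int ^ 'd) list"
    have e: "ennreal (exp (- sum_list (map \<omega> zs))) =
        (\<Prod>z\<in>set zs. ennreal (exp (- (real (count_list zs z) * \<omega> z))))" for \<omega>
      by (simp add: sum_list_map_eq_sum_local_time[of "set zs"] prod_ennreal exp_sum sum_negf[symmetric])
    have "(\<integral>\<^sup>+\<omega>. ennreal (exp (- sum_list (map \<omega> zs))) \<partial>?P) =
        (\<Prod>z\<in>set zs. \<integral>\<^sup>+t. ennreal (exp (- (real (count_list zs z) * t))) \<partial>interval_measure \<phi>)"
      unfolding e potential_law_def using ps by (intro nn_integral_PiM_prod) auto
    also have "\<dots> = ennreal (local_time_weight (laplace_transform \<phi>) zs)"
      unfolding nn_integral_laplace[OF assms] local_time_weight_def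
      using laplace_sequence.pos[OF laplace_sequence_laplace_transform[OF assms]]
      by (intro prod_ennreal) (auto intro: less_imp_le)
    finally have i: "(\<integral>\<^sup>+\<omega>. ennreal (exp (- sum_list (map \<omega> zs))) \<partial>?P) =
        ennreal (local_time_weight (laplace_transform \<phi>) zs)" .
    have "(\<integral>\<^sup>+\<omega>. ennreal (exp (- sum_list (map \<omega> zs))) * ennreal (step_probability zs) \<partial>?P) =
      ennreal (local_time_weight (laplace_transform \<phi>) zs) * ennreal (step_probability zs)"
      using meas_sum by (subst nn_integral_multc) (auto simp: i)
    also have "\<dots> = ennreal (step_probability zs * local_time_weight (laplace_transform \<phi>) zs)"
      using step_prob_pos[where 'd = 'd]
      by (subst ennreal_mult''[symmetric]) (auto simp: mult.commute)
    finally show "(\<integral>\<^sup>+\<omega>. ennreal (exp (- sum_list (map \<omega> zs))) * ennreal (step_probability zs) \<partial>?P) =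
      ennreal (step_probability zs * local_time_weight (laplace_transform \<phi>) zs)" .
  qed
  finally show ?thesis .
qed

section \<open>Growth rates of subadditive functions on the lattice\<close>
definition lattice_floor :: "real ^ 'd \<Rightarrow> int ^ 'd" where
  "lattice_floor x = (\<chi> i. \<lfloor>x $ i\<rfloor>)"

definition of_lattice :: "int ^ 'd \<Rightarrow> real ^ 'd" where
  "of_lattice u = (\<chi> i. real_of_int (u $ i))"

lemma floor_add_close:
  fixes a b :: real
  shows "\<bar>real_of_int \<lfloor>a + b\<rfloor> - (real_of_int \<lfloor>a\<rfloor> + real_of_int \<lfloor>b\<rfloor>)\<bar> \<le> 1"
proof -
  have "\<bar>\<lfloor>a + b\<rfloor> - (\<lfloor>a\<rfloor> + \<lfloor>b\<rfloor>)\<bar> \<le> 1" by linarith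
  then have "real_of_int \<bar>\<lfloor>a + b\<rfloor> - (\<lfloor>a\<rfloor> + \<lfloor>b\<rfloor>)\<bar> \<le> real_of_int 1" by (simp only: of_int_le_iff)
  then show ?thesis by simp
qed

lemma floor_uminus_close:
  fixes a :: real
  shows "\<bar>- real_of_int \<lfloor>a\<rfloor> - real_of_int \<lfloor>- a\<rfloor>\<bar> \<le> 1"
proof -
  have "\<bar>- \<lfloor>a\<rfloor> - \<lfloor>- a\<rfloor>\<bar> \<le> 1" by linarith
  then have "real_of_int \<bar>- \<lfloor>a\<rfloor> - \<lfloor>- a\<rfloor>\<bar> \<le> real_of_int 1" by (simp only: of_int_le_iff)
  then show ?thesis by simp
qed

text \<open>Fekete's lemma: up to a bounded remainder, \<open>g n\<close> is at most \<open>n div m\<close> times \<open>g m\<close> for each \<open>m\<close>.\<close>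
lemma fekete:
  fixes g :: "nat \<Rightarrow> real"
  assumes sub: "\<And>m n. g (m + n) \<le> g m + g n" and nonneg: "\<And>n. 0 \<le> g n"
  shows "(\<lambda>n. g n / real n) \<longlonglongrightarrow> (INF n\<in>{1..}. g n / real n)"
proof (rule LIMSEQ_I)
  let ?L = "INF n\<in>{1..}. g n / real n"
  have bdd: "bdd_below ((\<lambda>n. g n / real n) ` {1..})"
    using nonneg by (intro bdd_belowI[of _ 0]) auto
  have mult: "g (k * m + r) \<le> real k * g m + g r" for k m r
  proof (induction k)
    case (Suc k)
    have "g (Suc k * m + r) = g (m + (k * m + r))" by (simp add: add.assoc)
    also have "\<dots> \<le> g m + g (k * m + r)" by (rule sub)
    finally show ?case using Suc by (simp add: algebra_simps)
  qed simp
  fix e :: real assume "0 < e"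
  have "\<exists>m\<in>{1..}. g m / real m < ?L + e / 2"
    using \<open>0 < e\<close> cINF_less_iff[OF _ bdd, of "?L + e / 2"] by auto
  then obtain m where m: "1 \<le> m" "g m / real m < ?L + e / 2" by auto
  define R where "R = (\<Sum>r<m. g r)"
  have R: "g r \<le> R" if "r < m" for r
    unfolding R_def using that nonneg by (intro member_le_sum) auto
  have "(\<lambda>n. R / real n) \<longlonglongrightarrow> 0" by (rule lim_const_over_n)
  then obtain n0 where n0: "\<And>n. n \<ge> n0 \<Longrightarrow> \<bar>R / real n\<bar> < e / 2"
    using \<open>0 < e\<close> LIMSEQ_D[of "\<lambda>n. R / real n" 0 "e / 2"] by auto
  show "\<exists>no. \<forall>n\<ge>no. norm (g n / real n - ?L) < e"
  proof (intro exI allI impI)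
    fix n assume n: "max n0 1 \<le> n"
    have "g n \<le> real (n div m) * g m + g (n mod m)"
      using mult[of "n div m" m "n mod m"] by simp
    also have "real (n div m) * g m \<le> (real n / real m) * g m"
      using nonneg by (intro mult_right_mono of_nat_div_le_of_nat) auto
    also have "g (n mod m) \<le> R" using m by (intro R) auto
    finally have "g n / real n \<le> g m / real m + R / real n"
      using n m by (simp add: field_simps)
    also have "\<dots> < ?L + e" using m(2) n0[of n] n abs_less_iff[of "R / real n"] by linarith
    finally have "g n / real n < ?L + e" .
    moreover have "?L \<le> g n / real n" using n by (intro cINF_lower[OF bdd]) auto
    ultimately show "norm (g n / real n - ?L) < e" using \<open>0 < e\<close> by simp
  qed
qed

text \<open>Such a function is Lipschitz, hence changes only boundedly when a lattice point is moved by a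
  bounded amount.  The limit of \<open>B(\<lfloor>t x\<rfloor>) / t\<close> as \<open>t \<rightarrow> \<infinity>\<close> along the reals therefore exists for every
  real vector \<open>x\<close>, and it inherits subadditivity; homogeneity is a change of the variable \<open>t\<close>.\<close>
locale subadditive_lattice_function =
  fixes B :: "int ^ 'd::finite \<Rightarrow> real" and K :: real
  assumes nonneg: "0 \<le> B u"
    and subadd: "B (u + v) \<le> B u + B v"
    and symmetric: "B (- u) = B u"
    and K_nonneg: "0 \<le> K"
    and bounded: "B u \<le> K * (\<Sum>i\<in>UNIV. real_of_int \<bar>u $ i\<bar>)"
begin

lemma close:
  assumes "\<And>i. real_of_int \<bar>u $ i - v $ i\<bar> \<le> m"
  shows "\<bar>B u - B v\<bar> \<le> K * (real CARD('d) * m)"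
proof -
  have *: "B u - B v \<le> K * (real CARD('d) * m)" if "\<And>i. real_of_int \<bar>u $ i - v $ i\<bar> \<le> m" for u v
  proof -
    have "B u \<le> B v + B (u - v)" using subadd[of v "u - v"] by simp
    also have "B (u - v) \<le> K * (\<Sum>i\<in>UNIV. real_of_int \<bar>(u - v) $ i\<bar>)" by (rule bounded)
    also have "\<dots> \<le> K * (real CARD('d) * m)"
      using that sum_bounded_above[of UNIV "\<lambda>i. real_of_int \<bar>(u - v) $ i\<bar>" m] K_nonneg
      by (intro mult_left_mono) auto
    finally show ?thesis by simp
  qed
  from *[of u v] *[of v u] assms show ?thesis by (auto simp: abs_le_iff abs_minus_commute)
qed

definition growth_rate :: "real ^ 'd \<Rightarrow> real" where
  "growth_rate x = Lim at_top (\<lambda>t. B (lattice_floor (t *\<^sub>R x)) / t)"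

text \<open>Rounding makes \<open>n \<mapsto> B(\<lfloor>n x\<rfloor>)\<close> subadditive only up to a constant, which is removed by adding
  that constant before applying Fekete's lemma.  Passing from integers to reals costs another
  bounded error.\<close>
lemma growth_rate_tendsto: "((\<lambda>t. B (lattice_floor (t *\<^sub>R x)) / t) \<longlongrightarrow> growth_rate x) at_top"
proof -
  let ?b = "\<lambda>t. B (lattice_floor (t *\<^sub>R x))"
  define C where "C = K * (real CARD('d) * 1)"
  define g where "g n = ?b (real n) + C" for n
  have C: "0 \<le> C" using K_nonneg by (simp add: C_def)
  have "g (m + n) \<le> g m + g n" for m n
  proof -
    have "\<bar>?b (real (m + n)) - B (lattice_floor (real m *\<^sub>R x) + lattice_floor (real n *\<^sub>R x))\<bar> \<le> C"
      unfolding C_def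
    proof (rule close)
      show "real_of_int \<bar>lattice_floor (real (m + n) *\<^sub>R x) $ i - (lattice_floor (real m *\<^sub>R x) + lattice_floor (real n *\<^sub>R x)) $ i\<bar> \<le> 1" for i
        using floor_add_close[of "real m * x $ i" "real n * x $ i"]
        by (simp add: lattice_floor_def distrib_right)
    qed
    with subadd[of "lattice_floor (real m *\<^sub>R x)" "lattice_floor (real n *\<^sub>R x)"] show ?thesis
      by (simp add: g_def)
  qed
  moreover have "0 \<le> g n" for n using nonneg C by (simp add: g_def)
  ultimately obtain L where L: "(\<lambda>n. g n / real n) \<longlonglongrightarrow> L" using fekete by blast
  define D where "D = K * (real CARD('d) * ((\<Sum>i\<in>UNIV. \<bar>x $ i\<bar>) + 1)) + C"
  have nt: "filterlim (\<lambda>t::real. nat \<lfloor>t\<rfloor>) sequentially at_top"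
    by (intro filterlim_compose[OF filterlim_nat_sequentially filterlim_floor_sequentially])
  have ratio: "((\<lambda>t::real. real (nat \<lfloor>t\<rfloor>) / t) \<longlongrightarrow> 1) at_top"
  proof (rule tendsto_sandwich)
    show "((\<lambda>t::real. 1 - 1 / t) \<longlongrightarrow> 1) at_top"
      using tendsto_diff[OF tendsto_const[of 1] tendsto_divide_0[OF tendsto_const[of "1::real"] filterlim_at_top_imp_at_infinity[OF filterlim_ident]]]
      by simp
    show "\<forall>\<^sub>F t::real in at_top. 1 - 1 / t \<le> real (nat \<lfloor>t\<rfloor>) / t"
    proof (rule eventually_mono[OF eventually_gt_at_top[of 0]])
      fix t :: real assume "0 < t"
      moreover have "t - 1 \<le> real (nat \<lfloor>t\<rfloor>)" by linarith
      ultimately have "(t - 1) / t \<le> real (nat \<lfloor>t\<rfloor>) / t" by (intro divide_right_mono) auto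
      with \<open>0 < t\<close> show "1 - 1 / t \<le> real (nat \<lfloor>t\<rfloor>) / t" by (simp add: diff_divide_distrib)
    qed
    show "\<forall>\<^sub>F t::real in at_top. real (nat \<lfloor>t\<rfloor>) / t \<le> 1"
      by (rule eventually_mono[OF eventually_gt_at_top[of 0]]) (simp add: field_simps)
  qed (rule tendsto_const)
  have main: "((\<lambda>t. g (nat \<lfloor>t\<rfloor>) / real (nat \<lfloor>t\<rfloor>) * (real (nat \<lfloor>t\<rfloor>) / t)) \<longlongrightarrow> L * 1) at_top"
    by (intro tendsto_mult ratio filterlim_compose[OF L nt])
  have "((\<lambda>t. ?b t / t - g (nat \<lfloor>t\<rfloor>) / real (nat \<lfloor>t\<rfloor>) * (real (nat \<lfloor>t\<rfloor>) / t)) \<longlongrightarrow> 0) at_top"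
  proof (rule Lim_null_comparison)
    show "((\<lambda>t. D / t) \<longlongrightarrow> 0) at_top"
      by (rule tendsto_divide_0[OF tendsto_const filterlim_at_top_imp_at_infinity[OF filterlim_ident]])
    show "\<forall>\<^sub>F t in at_top. norm (?b t / t - g (nat \<lfloor>t\<rfloor>) / real (nat \<lfloor>t\<rfloor>) * (real (nat \<lfloor>t\<rfloor>) / t)) \<le> D / t"
    proof (rule eventually_mono[OF eventually_ge_at_top[of 1]])
      fix t :: real assume t: "1 \<le> t"
      let ?n = "nat \<lfloor>t\<rfloor>"
      have n: "real ?n \<le> t" "t < real ?n + 1" "0 < ?n" using t by linarith+
      have "\<bar>?b t - ?b (real ?n)\<bar> \<le> K * (real CARD('d) * ((\<Sum>i\<in>UNIV. \<bar>x $ i\<bar>) + 1))"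
      proof (rule close)
        fix i
        have "\<bar>t * x $ i - real ?n * x $ i\<bar> = (t - real ?n) * \<bar>x $ i\<bar>"
          using n by (simp add: abs_mult left_diff_distrib[symmetric])
        also have "\<dots> \<le> 1 * \<bar>x $ i\<bar>" using n by (intro mult_right_mono) linarith+
        also have "\<bar>x $ i\<bar> \<le> (\<Sum>i\<in>UNIV. \<bar>x $ i\<bar>)" by (rule member_le_sum) auto
        finally show "real_of_int \<bar>lattice_floor (t *\<^sub>R x) $ i - lattice_floor (real ?n *\<^sub>R x) $ i\<bar> \<le> (\<Sum>i\<in>UNIV. \<bar>x $ i\<bar>) + 1"
          unfolding lattice_floor_def by simp linarith
      qed
      then have "\<bar>?b t - g ?n\<bar> \<le> D" using C by (simp add: g_def D_def)
      then have "\<bar>(?b t - g ?n) / t\<bar> \<le> D / t" using t by (simp add: divide_right_mono)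
      moreover have "g ?n / real ?n * (real ?n / t) = g ?n / t"
      proof -
        have "a / b * (b / t) = a / t" if "0 < b" for a b :: real using that by simp
        moreover have "0 < real ?n" using n(3) by (simp only: of_nat_0_less_iff)
        ultimately show ?thesis by blast
      qed
      ultimately show "norm (?b t / t - g ?n / real ?n * (real ?n / t)) \<le> D / t"
        by (simp only: diff_divide_distrib real_norm_def)
    qed
  qed
  from tendsto_add[OF this main] have "((\<lambda>t. ?b t / t) \<longlongrightarrow> L) at_top" by simp
  then show ?thesis unfolding growth_rate_def by (subst tendsto_Lim) auto
qed

text \<open>A bounded error is invisible to the growth rate.\<close>
lemma growth_rate_eqI:
  assumes "\<And>t. 0 < t \<Longrightarrow> \<bar>f t - B (lattice_floor (t *\<^sub>R x))\<bar> \<le> C"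
  shows "((\<lambda>t. f t / t) \<longlongrightarrow> growth_rate x) at_top"
proof -
  have "((\<lambda>t. f t / t - B (lattice_floor (t *\<^sub>R x)) / t) \<longlongrightarrow> 0) at_top"
  proof (rule Lim_null_comparison)
    show "((\<lambda>t. C / t) \<longlongrightarrow> 0) at_top"
      by (rule tendsto_divide_0[OF tendsto_const filterlim_at_top_imp_at_infinity[OF filterlim_ident]])
    show "\<forall>\<^sub>F t in at_top. norm (f t / t - B (lattice_floor (t *\<^sub>R x)) / t) \<le> C / t"
      by (rule eventually_mono[OF eventually_gt_at_top[of 0]])
         (use assms in \<open>simp add: diff_divide_distrib[symmetric] divide_right_mono\<close>)
  qed
  from tendsto_add[OF this growth_rate_tendsto[of x]] show ?thesis by simp
qed

lemma growth_rate_nonneg: "0 \<le> growth_rate x"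
  by (rule tendsto_lowerbound[OF growth_rate_tendsto])
     (auto intro!: eventually_mono[OF eventually_gt_at_top[of 0]] nonneg divide_nonneg_pos)

lemma growth_rate_add: "growth_rate (x + y) \<le> growth_rate x + growth_rate y"
proof -
  define C where "C = K * (real CARD('d) * 1)"
  let ?f = "\<lambda>t. B (lattice_floor (t *\<^sub>R x) + lattice_floor (t *\<^sub>R y))"
  have "((\<lambda>t. ?f t / t) \<longlongrightarrow> growth_rate (x + y)) at_top"
  proof (rule growth_rate_eqI)
    fix t :: real
    show "\<bar>?f t - B (lattice_floor (t *\<^sub>R (x + y)))\<bar> \<le> C"
      unfolding C_def
      by (rule close) (simp add: lattice_floor_def distrib_left floor_add_close abs_minus_commute)
  qed
  then show ?thesis
    by (rule tendsto_le[OF _ tendsto_add[OF growth_rate_tendsto growth_rate_tendsto], rotated])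
       (auto intro!: eventually_mono[OF eventually_gt_at_top[of 0]] divide_right_mono subadd
         simp: add_divide_distrib[symmetric])
qed

lemma growth_rate_uminus: "growth_rate (- x) = growth_rate x"
proof -
  define C where "C = K * (real CARD('d) * 1)"
  have "((\<lambda>t. B (lattice_floor (t *\<^sub>R x)) / t) \<longlongrightarrow> growth_rate (- x)) at_top"
  proof (rule growth_rate_eqI)
    fix t :: real
    have "\<bar>B (- lattice_floor (t *\<^sub>R x)) - B (lattice_floor (t *\<^sub>R (- x)))\<bar> \<le> C"
      unfolding C_def by (rule close) (simp add: lattice_floor_def floor_uminus_close)
    then show "\<bar>B (lattice_floor (t *\<^sub>R x)) - B (lattice_floor (t *\<^sub>R (- x)))\<bar> \<le> C"
      by (simp add: symmetric)
  qed
  from tendsto_unique[OF _ this growth_rate_tendsto] show ?thesis by simp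
qed

lemma growth_rate_scale_pos:
  assumes "0 < c"
  shows "growth_rate (c *\<^sub>R x) = c * growth_rate x"
proof -
  have "filterlim (\<lambda>t. c * t) at_top at_top"
    using assms by (rule filterlim_tendsto_pos_mult_at_top[OF tendsto_const _ filterlim_ident])
  from tendsto_mult[OF tendsto_const[of c] filterlim_compose[OF growth_rate_tendsto[of x] this]]
  have "((\<lambda>t. B (lattice_floor (t *\<^sub>R (c *\<^sub>R x))) / t) \<longlongrightarrow> c * growth_rate x) at_top"
    using assms by (simp add: mult.commute)
  from tendsto_unique[OF _ growth_rate_tendsto this] show ?thesis by simp
qed

lemma growth_rate_zero: "growth_rate 0 = 0"
  using growth_rate_scale_pos[of 2 0] by simp

lemma growth_rate_scale: "growth_rate (c *\<^sub>R x) = \<bar>c\<bar> * growth_rate x"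
proof -
  consider "c = 0" | "0 < c" | "0 < - c" by linarith
  then show ?thesis
  proof cases
    case 3
    then show ?thesis using growth_rate_scale_pos[OF 3, of "- x"] by (simp add: growth_rate_uminus)
  qed (auto simp: growth_rate_zero growth_rate_scale_pos)
qed

lemma seminorm_growth_rate: "seminorm growth_rate"
  unfolding seminorm_def using growth_rate_nonneg growth_rate_scale growth_rate_add by blast

lemma growth_rate_lattice:
  "(\<lambda>n. B (int n *s u) / real n) \<longlonglongrightarrow> growth_rate (of_lattice u)"
  "(INF n\<in>{1..}. B (int n *s u) / real n) = growth_rate (of_lattice u)"
proof -
  have "lattice_floor (real n *\<^sub>R of_lattice u) = int n *s u" for n
    by (simp add: vec_eq_iff lattice_floor_def of_lattice_def) (metis floor_of_int of_int_mult of_int_of_nat_eq)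
  with filterlim_compose[OF growth_rate_tendsto[of "of_lattice u"] filterlim_real_sequentially]
  show 1: "(\<lambda>n. B (int n *s u) / real n) \<longlonglongrightarrow> growth_rate (of_lattice u)" by simp
  have "B (int (m + n) *s u) \<le> B (int m *s u) + B (int n *s u)" for m n
    using subadd[of "int m *s u" "int n *s u"] by (simp add: vector_sadd_rdistrib)
  from fekete[OF this nonneg] 1 show "(INF n\<in>{1..}. B (int n *s u) / real n) = growth_rate (of_lattice u)"
    by (rule LIMSEQ_unique)
qed

end

lemma seminorm_sum_le:
  assumes "finite S" "seminorm N"
  shows "N (\<Sum>i\<in>S. f i) \<le> (\<Sum>i\<in>S. N (f i))"
  using assms
proof (induction S rule: finite_induct)
  case empty
  have "N (0 *\<^sub>R undefined) = \<bar>0\<bar> * N undefined" using empty unfolding seminorm_def by blast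
  then show ?case by simp
next
  case (insert a S)
  have "N (f a + sum f S) \<le> N (f a) + N (sum f S)" using insert.prems unfolding seminorm_def by blast
  with insert show ?case by simp
qed

lemma seminorm_lattice_floor_close:
  fixes x :: "real ^ 'd::finite"
  assumes N: "seminorm N"
  shows "\<bar>N x - N (of_lattice (lattice_floor x))\<bar> \<le> (\<Sum>i\<in>UNIV. N (axis i 1 :: real ^ 'd))"
proof -
  define y where "y = x - of_lattice (lattice_floor x)"
  have tri: "N (a + b) \<le> N a + N b" for a b using N unfolding seminorm_def by blast
  have sc: "N (c *\<^sub>R a) = \<bar>c\<bar> * N a" for c a using N unfolding seminorm_def by blast
  have nn: "0 \<le> N a" for a using N unfolding seminorm_def by blast
  have minus: "N (- a) = N a" for a using sc[of "- 1" a] by simp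
  have "N y = N (\<Sum>i\<in>UNIV. (y $ i) *\<^sub>R axis i 1)"
    using basis_expansion[of y] by (simp add: scalar_mult_eq_scaleR)
  also have "\<dots> \<le> (\<Sum>i\<in>UNIV. \<bar>y $ i\<bar> * N (axis i 1))"
    using seminorm_sum_le[OF _ N, of UNIV "\<lambda>i. (y $ i) *\<^sub>R axis i 1"] by (simp add: sc)
  also have "\<dots> \<le> (\<Sum>i\<in>UNIV. 1 * N (axis i 1))"
  proof (intro sum_mono mult_right_mono nn)
    show "\<bar>y $ i\<bar> \<le> 1" for i
      unfolding y_def of_lattice_def lattice_floor_def by simp linarith
  qed
  finally have "N y \<le> (\<Sum>i\<in>UNIV. N (axis i 1))" by simp
  moreover have "N x \<le> N (of_lattice (lattice_floor x)) + N y"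
    using tri[of "of_lattice (lattice_floor x)" y] by (simp add: y_def)
  moreover have "N (of_lattice (lattice_floor x)) \<le> N x + N y"
    using tri[of x "- y"] minus[of y] by (simp add: y_def)
  ultimately show ?thesis by linarith
qed

text \<open>Two seminorms that agree on the lattice differ by a bounded amount, hence not at all, by
  homogeneity.\<close>
lemma seminorm_eqI_lattice:
  fixes N N' :: "real ^ 'd::finite \<Rightarrow> real"
  assumes N: "seminorm N" and N': "seminorm N'" and eq: "\<And>u. N (of_lattice u) = N' (of_lattice u)"
  shows "N = N'"
proof
  fix x
  define C where "C = (\<Sum>i\<in>UNIV. N (axis i 1)) + (\<Sum>i\<in>UNIV. N' (axis i 1))"
  have *: "t * \<bar>N x - N' x\<bar> \<le> C" if "0 < t" for t
  proof -
    have "N (t *\<^sub>R x) = t * N x" "N' (t *\<^sub>R x) = t * N' x"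
      using N N' that unfolding seminorm_def by auto
    then have "t * \<bar>N x - N' x\<bar> = \<bar>N (t *\<^sub>R x) - N' (t *\<^sub>R x)\<bar>"
      using that by (simp add: abs_mult right_diff_distrib[symmetric])
    then show ?thesis
      using seminorm_lattice_floor_close[OF N, of "t *\<^sub>R x"] seminorm_lattice_floor_close[OF N', of "t *\<^sub>R x"]
        eq[of "lattice_floor (t *\<^sub>R x)"] unfolding C_def by linarith
  qed
  show "N x = N' x"
  proof (rule ccontr)
    assume "N x \<noteq> N' x"
    then have p: "0 < \<bar>N x - N' x\<bar>" by simp
    have "0 \<le> C" using *[of 1] by (smt (verit))
    with *[of "(C + 1) / \<bar>N x - N' x\<bar>"] p show False by simp
  qed
qed

section \<open>The annealed Lyapunov exponent as a growth rate\<close>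
lemma lattice_l1_induct [case_names zero step]:
  fixes u :: "int ^ 'd::finite"
  assumes zero: "P 0"
    and step: "\<And>u v. P v \<Longrightarrow> adjacent v u \<Longrightarrow> (\<Sum>i\<in>UNIV. \<bar>u $ i\<bar>) = (\<Sum>i\<in>UNIV. \<bar>v $ i\<bar>) + 1 \<Longrightarrow> P u"
  shows "P u"
proof (induction "nat (\<Sum>i\<in>UNIV. \<bar>u $ i\<bar>)" arbitrary: u)
  case 0
  have "0 \<le> (\<Sum>i\<in>UNIV. \<bar>u $ i\<bar>)" by (rule sum_nonneg) simp
  with 0 have "(\<Sum>i\<in>UNIV. \<bar>u $ i\<bar>) = 0" by simp
  then have "u = 0" by (subst (asm) sum_nonneg_eq_0_iff) (auto simp: vec_eq_iff)
  with zero show ?case by simp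
next
  case (Suc n)
  then have "u \<noteq> 0" by auto
  then obtain k where k: "u $ k \<noteq> 0" by (auto simp: vec_eq_iff)
  define v where "v = u - axis k (sgn (u $ k))"
  have vk: "\<bar>u $ k\<bar> = \<bar>v $ k\<bar> + 1" using k by (auto simp: v_def axis_def sgn_if)
  have vi: "v $ i = u $ i" if "i \<noteq> k" for i using that by (simp add: v_def axis_def)
  have "(\<Sum>i\<in>UNIV. \<bar>u $ i\<bar>) = \<bar>u $ k\<bar> + (\<Sum>i\<in>UNIV - {k}. \<bar>u $ i\<bar>)"
    by (rule sum.remove) auto
  also have "\<dots> = 1 + (\<bar>v $ k\<bar> + (\<Sum>i\<in>UNIV - {k}. \<bar>v $ i\<bar>))" using vk vi by simp
  also have "\<bar>v $ k\<bar> + (\<Sum>i\<in>UNIV - {k}. \<bar>v $ i\<bar>) = (\<Sum>i\<in>UNIV. \<bar>v $ i\<bar>)"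
    by (rule sum.remove[symmetric]) auto
  finally have eq: "(\<Sum>i\<in>UNIV. \<bar>u $ i\<bar>) = (\<Sum>i\<in>UNIV. \<bar>v $ i\<bar>) + 1" by simp
  have "adjacent v u" using k by (auto simp: v_def adjacent_def unit_steps_def sgn_if)
  moreover have "P v" using Suc eq by auto
  ultimately show ?case using eq step by blast
qed

context laplace_sequence
begin

lemma passage_sum_finite: "passage_sum M x y < \<top>"
  using passage_sum_le_one[of x y] by (simp add: order_le_less_trans)

text \<open>The contribution of a shortest path, built up step by step through supermultiplicativity.  It makes
  the passage cost finite and at most linear in the distance.\<close>
lemma passage_sum_lower_bound:
  fixes u :: "int ^ 'd::finite"
  shows "ennreal ((step_prob TYPE('d) * M 1) ^ nat (\<Sum>i\<in>UNIV. \<bar>u $ i\<bar>)) \<le> passage_sum M 0 u"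
proof (induction u rule: lattice_l1_induct)
  case zero
  then show ?case by (simp add: passage_sum_self)
next
  case (step u v)
  let ?a = "step_prob TYPE('d) * M 1"
  have "nat (\<Sum>i\<in>UNIV. \<bar>u $ i\<bar>) = Suc (nat (\<Sum>i\<in>UNIV. \<bar>v $ i\<bar>))"
  proof -
    have "0 \<le> (\<Sum>i\<in>UNIV. \<bar>v $ i\<bar>)" by (rule sum_nonneg) simp
    then show ?thesis unfolding step(3) by linarith
  qed
  then have "ennreal (?a ^ nat (\<Sum>i\<in>UNIV. \<bar>u $ i\<bar>)) = ennreal (?a ^ nat (\<Sum>i\<in>UNIV. \<bar>v $ i\<bar>)) * ennreal ?a"
    using pos[of 1] step_prob_pos[where 'd = 'd]
    by (subst ennreal_mult''[symmetric]) (auto simp: mult.commute less_imp_le)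
  also have "\<dots> \<le> passage_sum M 0 v * passage_sum M v u"
    using step passage_sum_adjacent by (intro mult_mono) auto
  also have "\<dots> \<le> passage_sum M 0 u" by (rule passage_sum_supermultiplicative)
  finally show ?case .
qed

definition passage_cost :: "int ^ 'd::finite \<Rightarrow> real" where
  "passage_cost u = - ln (enn2real (passage_sum M 0 u))"

lemma passage_sum_eq_exp: "passage_sum M 0 u = ennreal (exp (- passage_cost u))"
proof -
  have "0 < (step_prob TYPE('a) * M 1) ^ nat (\<Sum>i\<in>UNIV. \<bar>u $ i\<bar>)"
    using pos[of 1] step_prob_pos[where 'd = 'a] by simp
  with passage_sum_lower_bound[of u] have "0 < passage_sum M 0 u"
    by (metis ennreal_less_zero_iff order_less_le_trans)
  then show ?thesis
    using passage_sum_finite[of 0 u] by (simp add: passage_cost_def enn2real_positive_iff)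
qed

lemma subadditive_lattice_function_passage_cost:
  "subadditive_lattice_function (passage_cost :: int ^ 'd::finite \<Rightarrow> real)
     (- ln (step_prob TYPE('d) * M 1))"
proof
  fix u v :: "int ^ 'd"
  have a: "0 < step_prob TYPE('d) * M 1"
    using pos[of 1] step_prob_pos[where 'd = 'd] by simp
  show "0 \<le> passage_cost u"
    using passage_sum_le_one[of 0 u] by (simp add: passage_sum_eq_exp)
  have "passage_sum M u (u + v) = passage_sum M 0 v"
    using passage_sum_translate[of M u 0 v] by simp
  with passage_sum_supermultiplicative[of 0 u "u + v"]
  have "ennreal (exp (- passage_cost u) * exp (- passage_cost v)) \<le> ennreal (exp (- passage_cost (u + v)))"
    by (simp add: passage_sum_eq_exp ennreal_mult)
  then have "exp (- passage_cost u + - passage_cost v) \<le> exp (- passage_cost (u + v))"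
    by (simp only: exp_add ennreal_le_iff exp_ge_zero)
  then show "passage_cost (u + v) \<le> passage_cost u + passage_cost v" by simp
  show "passage_cost (- u) = passage_cost u"
    using passage_sum_uminus[of M 0 u] by (simp add: passage_cost_def)
  have "step_prob TYPE('d) \<le> 1"
    using unit_steps_nonempty[where 'd = 'd] finite_unit_steps[where 'd = 'd]
    by (simp add: step_prob_def Suc_le_eq card_gt_0_iff)
  then have "step_prob TYPE('d) * M 1 \<le> 1"
    using le_one[of 1] pos[of 1] step_prob_pos[where 'd = 'd] by (intro mult_le_one) auto
  then show "0 \<le> - ln (step_prob TYPE('d) * M 1)" using a by simp
  have "ennreal ((step_prob TYPE('d) * M 1) ^ nat (\<Sum>i\<in>UNIV. \<bar>u $ i\<bar>)) \<le> ennreal (exp (- passage_cost u))"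
    using passage_sum_lower_bound[of u] by (simp add: passage_sum_eq_exp)
  then have "(step_prob TYPE('d) * M 1) ^ nat (\<Sum>i\<in>UNIV. \<bar>u $ i\<bar>) \<le> exp (- passage_cost u)"
    by simp
  then have "ln ((step_prob TYPE('d) * M 1) ^ nat (\<Sum>i\<in>UNIV. \<bar>u $ i\<bar>)) \<le> - passage_cost u"
    using a by (subst (asm) ln_le_cancel_iff[symmetric]) auto
  moreover have "real (nat (\<Sum>i\<in>UNIV. \<bar>u $ i\<bar>)) = (\<Sum>i\<in>UNIV. real_of_int \<bar>u $ i\<bar>)"
    using sum_nonneg[of UNIV "\<lambda>i. \<bar>u $ i\<bar>"] by simp
  ultimately show "passage_cost u \<le> - ln (step_prob TYPE('d) * M 1) * (\<Sum>i\<in>UNIV. real_of_int \<bar>u $ i\<bar>)"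
    using a by (simp add: ln_realpow mult.commute)
qed

end

lemma annealed_cost_eq_passage_cost:
  assumes "nonneg_distribution_function \<phi>"
  shows "annealed_cost \<phi> 0 u = laplace_sequence.passage_cost (laplace_transform \<phi>) u"
  by (simp add: annealed_cost_def annealed_travel_weight[OF assms]
      laplace_sequence.passage_cost_def[OF laplace_sequence_laplace_transform[OF assms]])

text \<open>The growth rate of the annealed cost meets the defining conditions, and it is the only seminorm that
  does, since these conditions prescribe the values on the lattice.\<close>
lemma
  fixes x :: "real ^ 'd::finite"
  assumes "nonneg_distribution_function \<phi>"
  shows annealed_lyapunov_exponent_tendsto:
      "((\<lambda>t. annealed_cost \<phi> 0 (lattice_floor (t *\<^sub>R x)) / t)
         \<longlongrightarrow> annealed_lyapunov_exponent \<phi> x) at_top" (is ?lim)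
    and is_annealed_lyapunov_exponent:
      "is_annealed_lyapunov_exponent \<phi> (annealed_lyapunov_exponent \<phi> :: real ^ 'd \<Rightarrow> real)" (is ?is)
proof -
  let ?M = "laplace_transform \<phi>"
  interpret laplace_sequence ?M by (rule laplace_sequence_laplace_transform[OF assms])
  interpret subadditive_lattice_function "passage_cost :: int ^ 'd \<Rightarrow> real"
      "- ln (step_prob TYPE('d) * ?M 1)"
    by (rule subadditive_lattice_function_passage_cost)
  have c: "annealed_cost \<phi> 0 u = passage_cost u" for u :: "int ^ 'd"
    by (rule annealed_cost_eq_passage_cost[OF assms])
  have is_gr: "is_annealed_lyapunov_exponent \<phi> growth_rate"
    unfolding is_annealed_lyapunov_exponent_def c
    using seminorm_growth_rate growth_rate_lattice by (simp add: of_lattice_def)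
  have eq: "annealed_lyapunov_exponent \<phi> = growth_rate"
    unfolding annealed_lyapunov_exponent_def
  proof (rule the_equality)
    show "is_annealed_lyapunov_exponent \<phi> growth_rate" by (rule is_gr)
    fix N :: "real ^ 'd \<Rightarrow> real" assume N: "is_annealed_lyapunov_exponent \<phi> N"
    show "N = growth_rate"
    proof (rule seminorm_eqI_lattice)
      show "N (of_lattice u) = growth_rate (of_lattice u)" for u
        using N is_gr unfolding is_annealed_lyapunov_exponent_def of_lattice_def
        by (metis LIMSEQ_unique)
    qed (use N seminorm_growth_rate in \<open>auto simp: is_annealed_lyapunov_exponent_def\<close>)
  qed
  show ?lim unfolding eq c by (rule growth_rate_tendsto)
  show ?is unfolding eq by (rule is_gr)
qed

section \<open>Inserting detours into a path\<close>

text \<open>A discrete intermediate value theorem: each coordinate grows by at most one per step.\<close>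
lemma first_passage_meets_level:
  assumes "zs \<in> first_passage_paths x y" "x $ i \<le> j" "j < y $ i"
  shows "\<exists>z\<in>set zs. z $ i = j"
proof -
  have "\<exists>z\<in>set zs. z $ i = j"
    if "successively adjacent (zs @ [y])" "hd (zs @ [y]) $ i \<le> j" for zs
    using that
  proof (induction zs)
    case Nil
    then show ?case using assms(3) by simp
  next
    case (Cons z zs)
    show ?case
    proof (cases "z $ i = j")
      case False
      have "adjacent z (hd (zs @ [y]))" "successively adjacent (zs @ [y])"
        using Cons.prems(1) by (auto simp: successively_Cons)
      then have "hd (zs @ [y]) $ i \<le> j"
        using adjacent_component_le[of z "hd (zs @ [y])" i] False Cons.prems(2) by simp
      with Cons.IH \<open>successively adjacent (zs @ [y])\<close> show ?thesis by auto
    qed auto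
  qed
  then show ?thesis using assms(1,2) by (auto simp: first_passage_paths_def)
qed

text \<open>The detour \<open>z, z + e, z\<close> replaces the first visit to each \<open>z \<in> A\<close>; dropping \<open>z\<close> from \<open>A\<close>
  afterwards ensures that \<open>z + e\<close> is visited only once.\<close>
fun insert_detours :: "'a::plus \<Rightarrow> 'a set \<Rightarrow> 'a list \<Rightarrow> 'a list" where
  "insert_detours e A [] = []"
| "insert_detours e A (z # zs) =
     (if z \<in> A then z # (z + e) # z # insert_detours e (A - {z}) zs
      else z # insert_detours e A zs)"

text \<open>The inverse operation needs to know only the set \<open>D\<close> of the sites \<open>z + e\<close>: on meeting such a site
  it drops the site together with the return to \<open>z\<close> after it.\<close>
fun remove_detours :: "'a set \<Rightarrow> 'a list \<Rightarrow> 'a list" where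
  "remove_detours D [] = []"
| "remove_detours D [z] = [z]"
| "remove_detours D (z # w # zs) =
     (if w \<in> D then z # remove_detours D (tl zs) else z # remove_detours D (w # zs))"

lemma remove_insert_detours:
  assumes "(\<lambda>z. z + e) ` A \<subseteq> D" "set zs \<inter> D = {}"
  shows "remove_detours D (insert_detours e A zs) = zs"
  using assms
proof (induction zs arbitrary: A)
  case (Cons z zs)
  show ?case
  proof (cases "z \<in> A")
    case True
    have "remove_detours D (insert_detours e (A - {z}) zs) = zs"
      by (rule Cons.IH) (use Cons.prems in auto)
    then show ?thesis using True Cons.prems by auto
  next
    case False
    have IH: "remove_detours D (insert_detours e A zs) = zs" using Cons by auto
    show ?thesis
    proof (cases zs)
      case (Cons w ws)
      then show ?thesis using False IH Cons.prems \<open>set (z # zs) \<inter> D = {}\<close> by auto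
    qed (use False in auto)
  qed
qed simp

lemma length_insert_detours:
  assumes "A \<subseteq> set zs"
  shows "length (insert_detours e A zs) = length zs + 2 * card A"
  using assms
proof (induction zs arbitrary: A)
  case (Cons z zs)
  have fin: "finite A" using Cons.prems by (rule finite_subset) simp
  show ?case
  proof (cases "z \<in> A")
    case True
    have "length (insert_detours e (A - {z}) zs) = length zs + 2 * card (A - {z})"
      by (rule Cons.IH) (use Cons.prems in auto)
    moreover have "card A = Suc (card (A - {z}))" using fin True by (rule card.remove)
    ultimately show ?thesis using True by (simp del: card_Diff_singleton card_Diff_insert)
  qed (use Cons in auto)
qed simp

lemma set_insert_detours:
  assumes "A \<subseteq> set zs"
  shows "set (insert_detours e A zs) = set zs \<union> (\<lambda>z. z + e) ` A"
  using assms
proof (induction zs arbitrary: A)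
  case (Cons z zs)
  show ?case
  proof (cases "z \<in> A")
    case True
    have "set (insert_detours e (A - {z}) zs) = set zs \<union> (\<lambda>z. z + e) ` (A - {z})"
      by (rule Cons.IH) (use Cons.prems in auto)
    with True show ?thesis by auto
  qed (use Cons in auto)
qed simp

lemma count_list_insert_detours:
  fixes e :: "'a::group_add"
  assumes "A \<subseteq> set zs"
  shows "count_list (insert_detours e A zs) v =
    count_list zs v + of_bool (v \<in> A) + of_bool (v - e \<in> A)"
  using assms
proof (induction zs arbitrary: A)
  case (Cons z zs)
  show ?case
  proof (cases "z \<in> A")
    case True
    have "count_list (insert_detours e (A - {z}) zs) v =
        count_list zs v + of_bool (v \<in> A - {z}) + of_bool (v - e \<in> A - {z})"
      by (rule Cons.IH) (use Cons.prems in auto)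
    moreover have "z + e = v \<longleftrightarrow> v - e = z" by (metis add_diff_cancel diff_add_cancel)
    ultimately show ?thesis using True by auto
  next
    case False
    then have "A \<subseteq> set zs" using Cons.prems by auto
    with Cons.IH False show ?thesis by simp
  qed
qed simp

lemma insert_detours_adjacent:
  assumes "successively adjacent (zs @ [y])" "e \<in> unit_steps"
  shows "successively adjacent (insert_detours e A zs @ [y]) \<and> hd (insert_detours e A zs @ [y]) = hd (zs @ [y])"
  using assms(1)
proof (induction zs arbitrary: A)
  case (Cons z zs)
  have a: "adjacent z (z + e)" "adjacent (z + e) z"
    using assms(2) uminus_unit_steps_iff[of e] by (auto simp: adjacent_def)
  have "adjacent z (hd (zs @ [y]))" "successively adjacent (zs @ [y])"
    using Cons.prems by (auto simp: successively_Cons)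
  with Cons.IH a show ?case by (auto simp: successively_Cons)
qed simp

definition once_visited :: "'a list \<Rightarrow> 'a set" where
  "once_visited zs = {z. count_list zs z = 1}"

lemma once_visited_subset: "once_visited zs \<subseteq> set zs"
  unfolding once_visited_def by (metis (mono_tags, lifting) count_list_0_iff mem_Collect_eq subsetI zero_neq_one)

lemma finite_once_visited [simp]: "finite (once_visited zs)"
  by (rule finite_subset[OF once_visited_subset]) simp

context
  fixes e :: "int ^ 'd::finite" and A :: "(int ^ 'd) set" and zs :: "(int ^ 'd) list"
  assumes A: "A \<subseteq> set zs" and fresh: "\<And>z. z \<in> A \<Longrightarrow> z + e \<notin> set zs"
begin

lemma detour_sites_once_visited: "(\<lambda>z. z + e) ` A \<subseteq> once_visited (insert_detours e A zs)"
proof clarify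
  fix z assume "z \<in> A"
  moreover from this have "z + e \<notin> A" using fresh A by auto
  moreover have "count_list zs (z + e) = 0" using fresh[OF \<open>z \<in> A\<close>] by (simp add: count_list_0_iff)
  ultimately show "z + e \<in> once_visited (insert_detours e A zs)"
    using A by (simp add: once_visited_def count_list_insert_detours)
qed

lemma card_once_visited_insert_detours:
  "card (once_visited (insert_detours e A zs)) \<le> card (once_visited zs) + card A"
proof -
  have "once_visited (insert_detours e A zs) \<subseteq> once_visited zs \<union> (\<lambda>z. z + e) ` A"
  proof
    fix v assume "v \<in> once_visited (insert_detours e A zs)"
    then have c: "count_list zs v + of_bool (v \<in> A) + of_bool (v - e \<in> A) = (1::nat)"
      using A by (simp add: once_visited_def count_list_insert_detours)
    show "v \<in> once_visited zs \<union> (\<lambda>z. z + e) ` A"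
    proof (cases "v - e \<in> A")
      case True
      then have "v \<in> (\<lambda>z. z + e) ` A" by (auto intro: image_eqI[of _ _ "v - e"])
      then show ?thesis by simp
    next
      case False
      have "v \<notin> A"
        using c A by (auto simp: count_list_0_iff)
      with c False show ?thesis by (simp add: once_visited_def)
    qed
  qed
  then have "card (once_visited (insert_detours e A zs)) \<le> card (once_visited zs \<union> (\<lambda>z. z + e) ` A)"
    by (intro card_mono) (auto intro: finite_subset[OF A])
  also have "\<dots> \<le> card (once_visited zs) + card ((\<lambda>z. z + e) ` A)" by (rule card_Un_le)
  also have "card ((\<lambda>z. z + e) ` A) \<le> card A" by (rule card_image_le) (auto intro: finite_subset[OF A])
  finally show ?thesis by simp
qed

end

text \<open>A detour adds one visit to \<open>z\<close>, costing at most a factor \<open>M 1\<close> by supermultiplicativity, and one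
  new site with a single visit, costing \<open>M 1\<close>.\<close>
lemma (in laplace_sequence) local_time_weight_insert_detours:
  fixes e :: "int ^ 'd::finite"
  assumes A: "A \<subseteq> set zs" and fresh: "\<And>z. z \<in> A \<Longrightarrow> z + e \<notin> set zs"
  shows "local_time_weight M zs * M 1 ^ (2 * card A) \<le> local_time_weight M (insert_detours e A zs)"
proof -
  let ?D = "(\<lambda>z. z + e) ` A" and ?zs' = "insert_detours e A zs"
  have fin: "finite A" by (rule finite_subset[OF A]) simp
  have disj: "set zs \<inter> ?D = {}" using fresh by auto
  have "local_time_weight M ?zs' = (\<Prod>v\<in>set zs \<union> ?D. M (count_list ?zs' v))"
    by (simp add: local_time_weight_def set_insert_detours[OF A])
  also have "\<dots> = (\<Prod>v\<in>set zs. M (count_list ?zs' v)) * (\<Prod>v\<in>?D. M (count_list ?zs' v))"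
    by (rule prod.union_disjoint) (use fin disj in auto)
  also have "(\<Prod>v\<in>?D. M (count_list ?zs' v)) = M 1 ^ card A"
  proof -
    have "(\<Prod>v\<in>?D. M (count_list ?zs' v)) = (\<Prod>v\<in>?D. M 1)"
      using detour_sites_once_visited[OF A fresh] by (intro prod.cong) (auto simp: once_visited_def)
    also have "\<dots> = M 1 ^ card A" by (simp add: card_image)
    finally show ?thesis .
  qed
  finally have eq: "local_time_weight M ?zs' = (\<Prod>v\<in>set zs. M (count_list ?zs' v)) * M 1 ^ card A" .
  have "local_time_weight M zs * M 1 ^ card A =
      (\<Prod>v\<in>set zs. M (count_list zs v)) * (\<Prod>v\<in>set zs. if v \<in> A then M 1 else 1)"
    using A by (simp add: local_time_weight_def prod.If_cases Int_absorb1)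
  also have "\<dots> = (\<Prod>v\<in>set zs. M (count_list zs v) * (if v \<in> A then M 1 else 1))"
    by (rule prod.distrib[symmetric])
  also have "\<dots> \<le> (\<Prod>v\<in>set zs. M (count_list ?zs' v))"
  proof (intro prod_mono conjI)
    fix v assume v: "v \<in> set zs"
    have "v - e \<notin> A" using fresh[of "v - e"] v by auto
    then show "M (count_list zs v) * (if v \<in> A then M 1 else 1) \<le> M (count_list ?zs' v)"
      using supermult[of "count_list zs v" 1] by (simp add: count_list_insert_detours[OF A])
    show "0 \<le> M (count_list zs v) * (if v \<in> A then M 1 else 1)"
      using pos by (simp add: less_imp_le)
  qed
  finally have "local_time_weight M zs * M 1 ^ card A * M 1 ^ card A \<le>
      (\<Prod>v\<in>set zs. M (count_list ?zs' v)) * M 1 ^ card A"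
    using pos by (intro mult_right_mono) (auto simp: less_imp_le)
  then show ?thesis by (simp add: eq power_add mult_2 mult.assoc)
qed

section \<open>The gain from detours in dimension at least two\<close>
lemma sum_power_card_Pow:
  fixes t :: "'a::comm_semiring_1"
  assumes "finite S"
  shows "(\<Sum>A\<in>Pow S. t ^ card A) = (1 + t) ^ card S"
  using prod_add[OF assms, of "\<lambda>_. t" "\<lambda>_. 1"] by (simp add: add.commute)

text \<open>On each level of the \<open>i\<close>-th coordinate below that of \<open>u\<close>, the site of the path with the largest
  \<open>k\<close>-th coordinate is chosen.  The step \<open>axis k 1\<close> stays on the level, so it leads neither to a
  visited site nor to \<open>u\<close>.\<close>
lemma detour_sites_exist:
  fixes u :: "int ^ 'd::finite"
  assumes zs: "zs \<in> first_passage_paths 0 u" and "i \<noteq> k"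
  shows "\<exists>T\<subseteq>set zs. card T = nat (u $ i) \<and> (\<forall>z\<in>T. z + axis k 1 \<notin> set (zs @ [u]))"
proof -
  have "\<exists>z. z \<in> set zs \<and> z $ i = j \<and> z + axis k 1 \<notin> set (zs @ [u])" if j: "j \<in> {0..<u $ i}" for j
  proof -
    let ?L = "{z \<in> set zs. z $ i = j}"
    have fin: "finite ?L" by simp
    have ne: "?L \<noteq> {}" using first_passage_meets_level[OF zs, of i j] j by auto
    define m where "m = Max ((\<lambda>z. z $ k) ` ?L)"
    have "m \<in> (\<lambda>z. z $ k) ` ?L" unfolding m_def using fin ne by (intro Max_in) auto
    then obtain z where z: "z \<in> ?L" "z $ k = m" by auto
    have zi: "(z + axis k 1) $ i = j" using z \<open>i \<noteq> k\<close> by (simp add: axis_def)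
    have "z + axis k 1 \<notin> set zs"
    proof
      assume "z + axis k 1 \<in> set zs"
      with zi have "z + axis k 1 \<in> ?L" by simp
      then have "(z + axis k 1) $ k \<le> m"
        unfolding m_def using fin by (intro Max_ge finite_imageI imageI)
      then show False using z by simp
    qed
    moreover have "z + axis k 1 \<noteq> u" using zi j by auto
    ultimately show ?thesis using z by auto
  qed
  then obtain f where f: "\<And>j. j \<in> {0..<u $ i} \<Longrightarrow> f j \<in> set zs \<and> f j $ i = j \<and> f j + axis k 1 \<notin> set (zs @ [u])"
    by metis
  have "inj_on f {0..<u $ i}" by (rule inj_onI) (metis f)
  then have "card (f ` {0..<u $ i}) = nat (u $ i)" by (simp add: card_image)
  with f show ?thesis by (intro exI[of _ "f ` {0..<u $ i}"]) auto
qed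

context laplace_sequence
begin

text \<open>Expand \<open>(1 + t)\<close> to the power \<open>u $ i\<close> as a sum of \<open>t\<close> to the power \<open>card A\<close> over the subsets \<open>A\<close> of
  the detour sites of a path, and replace each pair of a path and a subset \<open>A\<close> by the path with
  detours and the set \<open>D\<close> of new sites.  This map is injective, and \<open>D\<close> consists of once-visited sites
  of the new path.  A detour costs at most \<open>(q M(1))\<^sup>2\<close>, where \<open>q\<close> is the step probability, and adds at
  most one once-visited site, so each of its sites contributes at most \<open>r = t / (\<rho> (q M(1))\<^sup>2)\<close>.  Summing
  over all sets \<open>D\<close> of once-visited sites replaces \<open>\<rho>\<close> by \<open>(1 + r) \<rho>\<close>, and \<open>t\<close> is chosen to make
  this equal to \<open>1\<close>.\<close>
lemma passage_sum_detour_gain: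
  fixes u :: "int ^ 'd::finite"
  assumes "i \<noteq> k" and \<rho>: "0 < \<rho>" "\<rho> < 1"
  defines "t \<equiv> (1 - \<rho>) * (step_prob TYPE('d) * M 1) ^ 2"
  shows "ennreal ((1 + t) ^ nat (u $ i)) *
      (\<integral>\<^sup>+zs. ennreal (step_probability zs * local_time_weight M zs * \<rho> ^ card (once_visited zs))
         \<partial>count_space (first_passage_paths 0 u)) \<le> passage_sum M 0 u"
proof -
  let ?P = "first_passage_paths 0 u"
  define e where "e = (axis k 1 :: int ^ 'd)"
  define q where "q = step_prob TYPE('d)"
  define N where "N zs = card (once_visited zs)" for zs :: "(int ^ 'd) list"
  define w where "w zs = q ^ length zs * local_time_weight M zs" for zs :: "(int ^ 'd) list"
  define r where "r = (1 - \<rho>) / \<rho>"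
  define h where "h p = (case p of (zs, D) \<Rightarrow> ennreal (r ^ card D * (w zs * \<rho> ^ N zs)))"
    for p :: "(int ^ 'd) list \<times> (int ^ 'd) set"
  have q: "0 < q" by (simp add: q_def step_prob_pos)
  have w: "0 < w zs" for zs
    unfolding w_def by (intro mult_pos_pos zero_less_power q local_time_weight_pos)
  have t: "0 \<le> t" and r: "0 \<le> r" using \<rho> q by (auto simp: t_def r_def)
  have tr: "t = r * \<rho> * (q * M 1) ^ 2" using \<rho> by (simp add: t_def r_def q_def)
  have e: "e \<in> unit_steps" by (simp add: e_def unit_steps_def)
  have "\<forall>zs\<in>?P. \<exists>T\<subseteq>set zs. card T = nat (u $ i) \<and> (\<forall>z\<in>T. z + e \<notin> set (zs @ [u]))"
    using detour_sites_exist[OF _ \<open>i \<noteq> k\<close>, of _ u] by (auto simp: e_def)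
  then obtain T where T: "\<And>zs. zs \<in> ?P \<Longrightarrow>
      T zs \<subseteq> set zs \<and> card (T zs) = nat (u $ i) \<and> (\<forall>z\<in>T zs. z + e \<notin> set (zs @ [u]))"
    by metis
  have finT: "finite (T zs)" if "zs \<in> ?P" for zs using T[OF that] finite_subset by blast
  define \<Phi> where "\<Phi> p = (case p of (zs, A) \<Rightarrow> (insert_detours e A zs, (\<lambda>z. z + e) ` A))"
    for p :: "(int ^ 'd) list \<times> (int ^ 'd) set"

  have "ennreal ((1 + t) ^ nat (u $ i)) * (\<integral>\<^sup>+zs. ennreal (w zs * \<rho> ^ N zs) \<partial>count_space ?P) =
      (\<integral>\<^sup>+zs. ennreal ((1 + t) ^ nat (u $ i)) * ennreal (w zs * \<rho> ^ N zs) \<partial>count_space ?P)"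
    by (simp add: nn_integral_cmult)
  also have "\<dots> = (\<integral>\<^sup>+zs. (\<integral>\<^sup>+A. ennreal (t ^ card A * (w zs * \<rho> ^ N zs)) \<partial>count_space (Pow (T zs))) \<partial>count_space ?P)"
  proof (rule nn_integral_cong)
    fix zs assume "zs \<in> space (count_space ?P)"
    then have zs: "zs \<in> ?P" by simp
    have "(\<integral>\<^sup>+A. ennreal (t ^ card A * (w zs * \<rho> ^ N zs)) \<partial>count_space (Pow (T zs))) =
        (\<Sum>A\<in>Pow (T zs). ennreal (t ^ card A * (w zs * \<rho> ^ N zs)))"
      using finT[OF zs] by (simp add: nn_integral_count_space_finite)
    also have "\<dots> = ennreal (\<Sum>A\<in>Pow (T zs). t ^ card A * (w zs * \<rho> ^ N zs))"
      using t w[of zs] \<rho> by (intro sum_ennreal) (simp add: less_imp_le)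
    also have "(\<Sum>A\<in>Pow (T zs). t ^ card A * (w zs * \<rho> ^ N zs)) = (1 + t) ^ nat (u $ i) * (w zs * \<rho> ^ N zs)"
      using sum_power_card_Pow[OF finT[OF zs], of t] T[OF zs] by (simp add: sum_distrib_right[symmetric])
    also have "ennreal \<dots> = ennreal ((1 + t) ^ nat (u $ i)) * ennreal (w zs * \<rho> ^ N zs)"
      using t by (intro ennreal_mult') simp
    finally show "ennreal ((1 + t) ^ nat (u $ i)) * ennreal (w zs * \<rho> ^ N zs) =
        (\<integral>\<^sup>+A. ennreal (t ^ card A * (w zs * \<rho> ^ N zs)) \<partial>count_space (Pow (T zs)))" by simp
  qed
  also have "\<dots> = (\<integral>\<^sup>+(zs, A). ennreal (t ^ card A * (w zs * \<rho> ^ N zs)) \<partial>count_space (Sigma ?P (\<lambda>zs. Pow (T zs))))"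
    by (rule nn_integral_count_space_Sigma)
  also have "\<dots> \<le> (\<integral>\<^sup>+p. h (\<Phi> p) \<partial>count_space (Sigma ?P (\<lambda>zs. Pow (T zs))))"
  proof (rule nn_integral_mono, clarsimp)
    fix zs A assume zs: "zs \<in> ?P" and A: "A \<subseteq> T zs"
    have A1: "A \<subseteq> set zs" and A2: "\<And>z. z \<in> A \<Longrightarrow> z + e \<notin> set zs" using T[OF zs] A by auto
    let ?zs' = "insert_detours e A zs"
    have "w zs * (q * M 1) ^ (2 * card A) = q ^ length ?zs' * (local_time_weight M zs * M 1 ^ (2 * card A))"
      by (simp add: w_def length_insert_detours[OF A1] power_add power_mult_distrib)
    also have "\<dots> \<le> w ?zs'"
      unfolding w_def using q local_time_weight_insert_detours[OF A1 A2] by (intro mult_left_mono) auto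
    finally have w': "w zs * (q * M 1) ^ (2 * card A) \<le> w ?zs'" .
    have n': "\<rho> ^ (N zs + card A) \<le> \<rho> ^ N ?zs'"
      unfolding N_def using card_once_visited_insert_detours[OF A1 A2] \<rho> by (intro power_decreasing) auto
    have "t ^ card A = r ^ card A * \<rho> ^ card A * (q * M 1) ^ (2 * card A)"
      by (simp only: tr power_mult_distrib power_mult)
    then have "t ^ card A * (w zs * \<rho> ^ N zs) =
        r ^ card A * ((w zs * (q * M 1) ^ (2 * card A)) * \<rho> ^ (N zs + card A))"
      by (simp only: power_add mult_ac)
    also have "\<dots> \<le> r ^ card A * (w ?zs' * \<rho> ^ N ?zs')"
      using w' n' r \<rho> w[of ?zs'] by (intro mult_left_mono mult_mono) auto
    also have "card A = card ((\<lambda>z. z + e) ` A)" by (simp add: card_image)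
    finally show "ennreal (t ^ card A * (w zs * \<rho> ^ N zs)) \<le> h (\<Phi> (zs, A))"
      by (simp add: h_def \<Phi>_def ennreal_leI card_image)
  qed
  also have "\<dots> \<le> (\<integral>\<^sup>+p. h p \<partial>count_space (Sigma ?P (\<lambda>zs. Pow (once_visited zs))))"
  proof (rule nn_integral_count_space_inj_le)
    show "inj_on \<Phi> (Sigma ?P (\<lambda>zs. Pow (T zs)))"
    proof (rule inj_onI, clarify)
      fix zs A zs' A'
      assume zs: "zs \<in> ?P" "A \<subseteq> T zs" and zs': "zs' \<in> ?P" "A' \<subseteq> T zs'" and eq: "\<Phi> (zs, A) = \<Phi> (zs', A')"
      have D: "(\<lambda>z. z + e) ` A = (\<lambda>z. z + e) ` A'" and I: "insert_detours e A zs = insert_detours e A' zs'"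
        using eq by (auto simp: \<Phi>_def)
      from D have "A = A'" by (subst (asm) inj_image_eq_iff) (auto simp: inj_def)
      moreover have "zs = zs'"
      proof -
        let ?D = "(\<lambda>z. z + e) ` A"
        have "set zs \<inter> ?D = {}" "set zs' \<inter> ?D = {}"
          using T[OF zs(1)] T[OF zs'(1)] zs(2) zs'(2) \<open>A = A'\<close> by auto
        then have "remove_detours ?D (insert_detours e A zs) = zs" "remove_detours ?D (insert_detours e A' zs') = zs'"
          by (intro remove_insert_detours; simp add: D)+
        then show ?thesis by (simp only: I)
      qed
      ultimately show "zs = zs' \<and> A = A'" by simp
    qed
    show "\<Phi> ` Sigma ?P (\<lambda>zs. Pow (T zs)) \<subseteq> Sigma ?P (\<lambda>zs. Pow (once_visited zs))"
    proof (rule image_subsetI, clarify)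
      fix zs A assume zs: "zs \<in> ?P" and A: "A \<subseteq> T zs"
      have A1: "A \<subseteq> set zs" and A2: "\<And>z. z \<in> A \<Longrightarrow> z + e \<notin> set zs" and A3: "u \<notin> (\<lambda>z. z + e) ` A"
        using T[OF zs] A by auto
      have "insert_detours e A zs \<in> ?P"
        using zs insert_detours_adjacent[of zs u e A] e set_insert_detours[OF A1, of e] A3
        by (auto simp: first_passage_paths_def)
      with detour_sites_once_visited[OF A1 A2]
      show "\<Phi> (zs, A) \<in> Sigma ?P (\<lambda>zs. Pow (once_visited zs))" by (simp add: \<Phi>_def)
    qed
  qed
  also have "\<dots> = (\<integral>\<^sup>+zs. (\<integral>\<^sup>+D. ennreal (r ^ card D * (w zs * \<rho> ^ N zs)) \<partial>count_space (Pow (once_visited zs))) \<partial>count_space ?P)"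
    unfolding h_def by (rule nn_integral_count_space_Sigma[symmetric])
  also have "\<dots> = (\<integral>\<^sup>+zs. ennreal (w zs) \<partial>count_space ?P)"
  proof (rule nn_integral_cong)
    fix zs
    have "(\<integral>\<^sup>+D. ennreal (r ^ card D * (w zs * \<rho> ^ N zs)) \<partial>count_space (Pow (once_visited zs))) =
        (\<Sum>D\<in>Pow (once_visited zs). ennreal (r ^ card D * (w zs * \<rho> ^ N zs)))"
      by (simp add: nn_integral_count_space_finite)
    also have "\<dots> = ennreal (\<Sum>D\<in>Pow (once_visited zs). r ^ card D * (w zs * \<rho> ^ N zs))"
      using r w[of zs] \<rho> by (intro sum_ennreal) (simp add: less_imp_le)
    also have "(\<Sum>D\<in>Pow (once_visited zs). r ^ card D * (w zs * \<rho> ^ N zs)) = ((1 + r) * \<rho>) ^ N zs * w zs"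
      using sum_power_card_Pow[OF finite_once_visited, of r zs]
      by (simp add: sum_distrib_right[symmetric] N_def power_mult_distrib)
    also have "(1 + r) * \<rho> = 1" using \<rho> by (simp add: r_def field_simps)
    finally show "(\<integral>\<^sup>+D. ennreal (r ^ card D * (w zs * \<rho> ^ N zs)) \<partial>count_space (Pow (once_visited zs))) = ennreal (w zs)"
      by simp
  qed
  finally show ?thesis
    unfolding passage_sum_def w_def N_def q_def .
qed

end

lemma local_time_weight_once_visited_le:
  assumes M: "laplace_sequence M" and M': "laplace_sequence M'"
    and le: "\<And>k. M k \<le> M' k" and one: "M 1 \<le> \<rho> * M' 1"
  shows "local_time_weight M zs \<le> local_time_weight M' zs * \<rho> ^ card (once_visited zs)"
proof -
  have "local_time_weight M zs \<le> (\<Prod>z\<in>set zs. M' (count_list zs z) * (if z \<in> once_visited zs then \<rho> else 1))"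
    unfolding local_time_weight_def
    using le one laplace_sequence.pos[OF M]
    by (intro prod_mono conjI) (auto simp: once_visited_def mult.commute intro: less_imp_le)
  also have "\<dots> = local_time_weight M' zs * (\<Prod>z\<in>set zs. if z \<in> once_visited zs then \<rho> else 1)"
    by (simp add: prod.distrib local_time_weight_def)
  also have "(\<Prod>z\<in>set zs. if z \<in> once_visited zs then \<rho> else 1) = \<rho> ^ card (once_visited zs)"
    using once_visited_subset[of zs] by (simp add: prod.If_cases Int_absorb1)
  finally show ?thesis .
qed

text \<open>A path weight for \<open>M\<close> is at most \<open>\<rho>\<close> to the number of once-visited sites times the weight for
  \<open>M'\<close>, with \<open>\<rho> = M 1 / M' 1\<close>, so the detour gain for \<open>M'\<close> applies.  It counts levels above \<open>0\<close>; a
  point with negative \<open>i\<close>-th coordinate is first reflected.\<close>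
lemma passage_cost_gap_multidimensional:
  fixes u :: "int ^ 'd::finite"
  assumes M: "laplace_sequence M" and M': "laplace_sequence M'"
    and le: "\<And>k. M k \<le> M' k" and less: "M 1 < M' 1" and "i \<noteq> (k :: 'd)"
  defines "t \<equiv> (1 - M 1 / M' 1) * (step_prob TYPE('d) * M' 1) ^ 2"
  shows "laplace_sequence.passage_cost M u \<ge> laplace_sequence.passage_cost M' u + ln (1 + t) * \<bar>u $ i\<bar>"
proof -
  interpret M: laplace_sequence M by (rule M)
  interpret M': laplace_sequence M' by (rule M')
  define \<rho> where "\<rho> = M 1 / M' 1"
  have \<rho>: "0 < \<rho>" "\<rho> < 1" using M.pos[of 1] M'.pos[of 1] less by (auto simp: \<rho>_def)
  have t: "0 < t" using \<rho> M'.pos[of 1] step_prob_pos[where 'd = 'd] by (simp add: t_def \<rho>_def)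
  have *: "M.passage_cost u \<ge> M'.passage_cost u + ln (1 + t) * real (nat (u $ i))" for u :: "int ^ 'd"
  proof -
    have "passage_sum M 0 u \<le> (\<integral>\<^sup>+zs. ennreal (step_probability zs * local_time_weight M' zs * \<rho> ^ card (once_visited zs))
         \<partial>count_space (first_passage_paths 0 u))"
      unfolding passage_sum_def
    proof (intro nn_integral_mono ennreal_leI)
      fix zs :: "(int ^ 'd) list"
      have "local_time_weight M zs \<le> local_time_weight M' zs * \<rho> ^ card (once_visited zs)"
        using M'.pos[of 1] by (intro local_time_weight_once_visited_le[OF M M' le]) (simp add: \<rho>_def)
      then show "step_probability zs * local_time_weight M zs \<le>
          step_probability zs * local_time_weight M' zs * \<rho> ^ card (once_visited zs)"
        using step_prob_pos[where 'd = 'd] by (simp add: mult.assoc mult_left_mono)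
    qed
    then have "ennreal ((1 + t) ^ nat (u $ i)) * passage_sum M 0 u \<le> ennreal ((1 + t) ^ nat (u $ i)) *
        (\<integral>\<^sup>+zs. ennreal (step_probability zs * local_time_weight M' zs * \<rho> ^ card (once_visited zs))
         \<partial>count_space (first_passage_paths 0 u))"
      by (rule mult_left_mono) simp
    also have "\<dots> \<le> passage_sum M' 0 u"
      using M'.passage_sum_detour_gain[OF \<open>i \<noteq> k\<close> \<rho>, of u] by (simp only: t_def \<rho>_def)
    finally have "ennreal ((1 + t) ^ nat (u $ i)) * passage_sum M 0 u \<le> passage_sum M' 0 u" .
    then have "ennreal ((1 + t) ^ nat (u $ i) * exp (- M.passage_cost u)) \<le> ennreal (exp (- M'.passage_cost u))"
      using t by (simp add: M.passage_sum_eq_exp M'.passage_sum_eq_exp ennreal_mult)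
    then have "(1 + t) ^ nat (u $ i) * exp (- M.passage_cost u) \<le> exp (- M'.passage_cost u)" by simp
    then have "exp (real (nat (u $ i)) * ln (1 + t) + - M.passage_cost u) \<le> exp (- M'.passage_cost u)"
      using t by (simp only: exp_add exp_of_nat_mult) simp
    then show ?thesis by (simp add: mult.commute)
  qed
  show ?thesis
  proof (cases "0 \<le> u $ i")
    case False
    have "M.passage_cost (- u) = M.passage_cost u" "M'.passage_cost (- u) = M'.passage_cost u"
      using passage_sum_uminus[of M 0 u] passage_sum_uminus[of M' 0 u]
      by (simp_all add: M.passage_cost_def M'.passage_cost_def)
    with *[of "- u"] False show ?thesis by simp
  qed (use *[of u] in simp)
qed

section \<open>Interpolation between two passage sums\<close>
lemma card_sites_ge_displacement:
  assumes "zs \<in> first_passage_paths 0 u"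
  shows "nat (u $ i) \<le> card (set zs)"
proof -
  have "{0..<u $ i} \<subseteq> (\<lambda>z. z $ i) ` set zs"
    using first_passage_meets_level[OF assms, of i] by force
  then have "card {0..<u $ i} \<le> card ((\<lambda>z. z $ i) ` set zs)" by (intro card_mono) auto
  also have "\<dots> \<le> card (set zs)" by (rule card_image_le) simp
  finally show ?thesis by simp
qed

text \<open>The right-hand side is the tangent at \<open>z\<close> of the concave function \<open>x \<mapsto> x powr \<theta>\<close>.\<close>
lemma powr_le_tangent:
  fixes x z \<theta> :: real
  assumes "0 < x" "0 < z" "0 \<le> \<theta>" "\<theta> \<le> 1"
  shows "x powr \<theta> \<le> z powr \<theta> * ((1 - \<theta>) + \<theta> / z * x)"
proof -
  have "(x / z) powr \<theta> * 1 powr (1 - \<theta>) \<le> \<theta> * (x / z) + (1 - \<theta>) * 1"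
    using assms by (intro Youngs_inequality_0) auto
  then have "z powr \<theta> * (x / z) powr \<theta> \<le> z powr \<theta> * ((1 - \<theta>) + \<theta> / z * x)"
    by (intro mult_left_mono) (auto simp: algebra_simps)
  moreover have "z powr \<theta> * (x / z) powr \<theta> = x powr \<theta>"
    using assms by (simp add: powr_mult[symmetric])
  ultimately show ?thesis by simp
qed

text \<open>Jensen's inequality for the concave power \<open>\<theta>\<close> and the subprobability weights of the paths,
  by the tangent at the passage sum itself.\<close>
lemma (in laplace_sequence) passage_sum_powr_le:
  fixes u :: "int ^ 'd::finite"
  assumes "0 \<le> \<theta>" "\<theta> \<le> 1"
  shows "(\<integral>\<^sup>+zs. ennreal (step_probability zs * local_time_weight M zs powr \<theta>)
      \<partial>count_space (first_passage_paths 0 u)) \<le> ennreal (exp (- \<theta> * passage_cost u))"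
proof -
  let ?P = "first_passage_paths 0 u"
  define z where "z = exp (- passage_cost u)"
  have z: "0 < z" by (simp add: z_def)
  have q: "0 \<le> step_probability zs" for zs :: "(int ^ 'd) list"
    using step_prob_pos[where 'd = 'd] by simp
  have "(\<integral>\<^sup>+zs. ennreal (step_probability zs * local_time_weight M zs powr \<theta>) \<partial>count_space ?P) \<le>
    (\<integral>\<^sup>+zs. ennreal (z powr \<theta> * (1 - \<theta>)) * ennreal (step_probability zs) +
        ennreal (z powr \<theta> * (\<theta> / z)) * ennreal (step_probability zs * local_time_weight M zs) \<partial>count_space ?P)"
  proof (rule nn_integral_mono)
    fix zs :: "(int ^ 'd) list"
    let ?L = "local_time_weight M zs"
    have L: "0 < ?L" by (rule local_time_weight_pos)
    have "step_probability zs * ?L powr \<theta> \<le> step_probability zs * (z powr \<theta> * ((1 - \<theta>) + \<theta> / z * ?L))"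
      by (intro mult_left_mono q powr_le_tangent L z assms)
    also have "\<dots> = z powr \<theta> * (1 - \<theta>) * step_probability zs + z powr \<theta> * (\<theta> / z) * (step_probability zs * ?L)"
      by (simp add: algebra_simps)
    finally show "ennreal (step_probability zs * ?L powr \<theta>) \<le> ennreal (z powr \<theta> * (1 - \<theta>)) * ennreal (step_probability zs) +
        ennreal (z powr \<theta> * (\<theta> / z)) * ennreal (step_probability zs * ?L)"
      using assms q[of zs] z L
      by (subst (1 2) ennreal_mult[symmetric], simp_all del: times_divide_eq_right, subst ennreal_plus[symmetric])
         (simp_all add: ennreal_leI del: times_divide_eq_right ennreal_plus)
  qed
  also have "\<dots> = ennreal (z powr \<theta> * (1 - \<theta>)) * (\<integral>\<^sup>+zs. ennreal (step_probability zs) \<partial>count_space ?P) +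
        ennreal (z powr \<theta> * (\<theta> / z)) * passage_sum M 0 u"
    by (simp add: nn_integral_add nn_integral_cmult passage_sum_def)
  also have "\<dots> \<le> ennreal (z powr \<theta> * (1 - \<theta>)) * 1 + ennreal (z powr \<theta> * (\<theta> / z)) * ennreal z"
    unfolding passage_sum_eq_exp z_def[symmetric]
    by (intro add_mono mult_left_mono passage_probability_le_one) auto
  also have "\<dots> = ennreal (z powr \<theta> * (1 - \<theta>) + z powr \<theta> * \<theta>)"
    using z assms by (subst ennreal_mult[symmetric]) (auto simp: ennreal_plus[symmetric] simp del: ennreal_plus)
  also have "z powr \<theta> * (1 - \<theta>) + z powr \<theta> * \<theta> = exp (- \<theta> * passage_cost u)"
    by (simp add: z_def powr_def algebra_simps)
  finally show ?thesis .
qed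

text \<open>Each visited site contributes a factor \<open>a powr s \<le> 1\<close>, and every path to \<open>u\<close> visits at least
  \<open>|u $ i|\<close> sites.  What remains is the power \<open>1 - s\<close> of the weight for \<open>M'\<close>.\<close>
lemma passage_cost_interpolation:
  fixes u :: "int ^ 'd::finite"
  assumes M: "laplace_sequence M" and M': "laplace_sequence M'"
    and s: "0 < s" "s < 1" and a: "0 < a" "a \<le> 1"
    and le: "\<And>k. 1 \<le> k \<Longrightarrow> M k \<le> M' k powr (1 - s) * a powr s"
  shows "laplace_sequence.passage_cost M u \<ge>
    (1 - s) * laplace_sequence.passage_cost M' u - s * ln a * \<bar>u $ i\<bar>"
proof -
  interpret M: laplace_sequence M by (rule M)
  interpret M': laplace_sequence M' by (rule M')
  have *: "M.passage_cost u \<ge> (1 - s) * M'.passage_cost u - s * ln a * real (nat (u $ i))" for u :: "int ^ 'd"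
  proof -
    let ?n = "nat (u $ i)"
    have "passage_sum M 0 u \<le> (\<integral>\<^sup>+zs. ennreal ((a powr s) ^ ?n) * ennreal (step_probability zs * local_time_weight M' zs powr (1 - s))
         \<partial>count_space (first_passage_paths 0 u))"
      unfolding passage_sum_def
    proof (intro nn_integral_mono)
      fix zs :: "(int ^ 'd) list" assume "zs \<in> space (count_space (first_passage_paths 0 u))"
      then have n: "?n \<le> card (set zs)" by (intro card_sites_ge_displacement) simp
      have "local_time_weight M zs \<le> (\<Prod>z\<in>set zs. M' (count_list zs z) powr (1 - s) * a powr s)"
        unfolding local_time_weight_def
      proof (intro prod_mono conjI le)
        fix z assume "z \<in> set zs"
        then have "count_list zs z \<noteq> 0" by (simp add: count_list_0_iff)
        then show "1 \<le> count_list zs z" by simp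
      qed (simp add: M.pos less_imp_le)
      also have "\<dots> = local_time_weight M' zs powr (1 - s) * (a powr s) ^ card (set zs)"
        using M'.pos by (simp add: prod.distrib local_time_weight_def prod_powr_distrib less_imp_le)
      also have "\<dots> \<le> local_time_weight M' zs powr (1 - s) * (a powr s) ^ ?n"
        using n a s by (intro mult_left_mono power_decreasing) (auto simp: powr_le1)
      finally have "step_probability zs * local_time_weight M zs \<le>
          step_probability zs * (local_time_weight M' zs powr (1 - s) * (a powr s) ^ ?n)"
        using step_prob_pos[where 'd = 'd] by (intro mult_left_mono) auto
      also have "\<dots> = (a powr s) ^ ?n * (step_probability zs * local_time_weight M' zs powr (1 - s))"
        by simp
      finally show "ennreal (step_probability zs * local_time_weight M zs) \<le>
          ennreal ((a powr s) ^ ?n) * ennreal (step_probability zs * local_time_weight M' zs powr (1 - s))"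
        using step_prob_pos[where 'd = 'd] by (subst ennreal_mult[symmetric]) (auto simp: ennreal_leI)
    qed
    also have "\<dots> = ennreal ((a powr s) ^ ?n) * (\<integral>\<^sup>+zs. ennreal (step_probability zs * local_time_weight M' zs powr (1 - s))
         \<partial>count_space (first_passage_paths 0 u))"
      by (simp add: nn_integral_cmult)
    also have "\<dots> \<le> ennreal ((a powr s) ^ ?n) * ennreal (exp (- (1 - s) * M'.passage_cost u))"
      using s by (intro mult_left_mono M'.passage_sum_powr_le) auto
    also have "\<dots> = ennreal ((a powr s) ^ ?n * exp (- (1 - s) * M'.passage_cost u))"
      by (simp add: ennreal_mult)
    finally have "exp (- M.passage_cost u) \<le> (a powr s) ^ ?n * exp (- (1 - s) * M'.passage_cost u)"
      using a by (simp add: M.passage_sum_eq_exp)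
    also have "(a powr s) ^ ?n = exp (real ?n * (s * ln a))"
      using a by (simp add: powr_def exp_of_nat_mult)
    also have "exp (real ?n * (s * ln a)) * exp (- (1 - s) * M'.passage_cost u) =
        exp (real ?n * (s * ln a) + - (1 - s) * M'.passage_cost u)" by (rule exp_add[symmetric])
    finally show ?thesis by (simp add: algebra_simps)
  qed
  show ?thesis
  proof (cases "0 \<le> u $ i")
    case False
    have "M.passage_cost (- u) = M.passage_cost u" "M'.passage_cost (- u) = M'.passage_cost u"
      using passage_sum_uminus[of M 0 u] passage_sum_uminus[of M' 0 u]
      by (simp_all add: M.passage_cost_def M'.passage_cost_def)
    with *[of "- u"] False show ?thesis by simp
  qed (use *[of u] in simp)
qed

section \<open>Comparing the Laplace transforms of two distribution functions\<close>

text \<open>Write \<open>e\<^sup>-\<^sup>k\<^sup>t\<close> as the integral of \<open>k e\<^sup>-\<^sup>k\<^sup>s\<close> over \<open>s \<ge> t\<close> and exchange the integrals: this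
  expresses the transform through the values of the distribution function, which is where
  dominance is stated.\<close>
lemma laplace_transform_layer_cake:
  assumes \<phi>: "nonneg_distribution_function \<phi>" and k: "1 \<le> k"
  shows "ennreal (laplace_transform \<phi> k) =
    (\<integral>\<^sup>+s. ennreal (real k * exp (- (real k * s)) * \<phi> s) \<partial>lborel)"
proof -
  interpret \<mu>: prob_space "interval_measure \<phi>" by (rule prob_space_interval_measure[OF \<phi>])
  interpret pair_sigma_finite lborel "interval_measure \<phi>" ..
  let ?g = "\<lambda>s. ennreal (real k * exp (- (real k * s)))"
  let ?f = "\<lambda>s t. (if t \<le> s then ?g s else 0)"
  have tail: "(\<integral>\<^sup>+s. ?f s t \<partial>lborel) = ennreal (exp (- (real k * t)))" for t :: real
  proof -
    have "(\<integral>\<^sup>+s. ?f s t \<partial>lborel) = (\<integral>\<^sup>+s. ?g s * indicator {t..} s \<partial>lborel)"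
      by (intro nn_integral_cong) (auto split: split_indicator)
    also have "\<dots> = ennreal (0 - (- exp (- (real k * t))))"
    proof (rule nn_integral_FTC_atLeast)
      show "((\<lambda>s. - exp (- (real k * s))) has_real_derivative real k * exp (- (real k * s))) (at s)" for s
        by (auto intro!: derivative_eq_intros)
      have "filterlim (\<lambda>s. real k * s) at_top at_top"
        using k by (intro filterlim_tendsto_pos_mult_at_top[OF tendsto_const _ filterlim_ident]) auto
      from tendsto_minus[OF filterlim_compose[OF exp_at_bot filterlim_compose[OF filterlim_uminus_at_bot_at_top this]]]
      show "((\<lambda>s. - exp (- (real k * s))) \<longlongrightarrow> 0) at_top" by simp
    qed auto
    finally show ?thesis by simp
  qed
  have "ennreal (laplace_transform \<phi> k) = (\<integral>\<^sup>+t. (\<integral>\<^sup>+s. ?f s t \<partial>lborel) \<partial>interval_measure \<phi>)"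
    by (simp only: tail nn_integral_laplace[OF \<phi>])
  also have "\<dots> = (\<integral>\<^sup>+s. (\<integral>\<^sup>+t. ?f s t \<partial>interval_measure \<phi>) \<partial>lborel)"
    by (rule Fubini') measurable
  also have "\<dots> = (\<integral>\<^sup>+s. ?g s * ennreal (\<phi> s) \<partial>lborel)"
  proof (intro nn_integral_cong)
    fix s
    have "(\<integral>\<^sup>+t. ?f s t \<partial>interval_measure \<phi>) = (\<integral>\<^sup>+t. ?g s * indicator {..s} t \<partial>interval_measure \<phi>)"
      by (intro nn_integral_cong) (auto split: split_indicator)
    then show "(\<integral>\<^sup>+t. ?f s t \<partial>interval_measure \<phi>) = ?g s * ennreal (\<phi> s)"
      by (simp add: nn_integral_cmult emeasure_interval_measure_atMost[OF \<phi>])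
  qed
  also have "\<dots> = (\<integral>\<^sup>+s. ennreal (real k * exp (- (real k * s)) * \<phi> s) \<partial>lborel)"
    by (intro nn_integral_cong) (simp add: ennreal_mult')
  finally show ?thesis .
qed

lemma nonneg_distribution_function_nonneg:
  assumes "nonneg_distribution_function \<phi>"
  shows "0 \<le> \<phi> t"
proof (cases "t < 0")
  case False
  have "\<phi> (- 1) = 0" using assms by (simp add: nonneg_distribution_function_def)
  moreover have "\<phi> (- 1) \<le> \<phi> t"
    using assms False by (intro monoD[of \<phi>]) (auto simp: nonneg_distribution_function_def)
  ultimately show ?thesis by simp
qed (use assms in \<open>simp add: nonneg_distribution_function_def\<close>)

lemma nonneg_distribution_function_at_right_less:
  assumes "nonneg_distribution_function \<phi>" "\<phi> t < m"
  obtains \<delta> where "0 < \<delta>" "\<And>s. t \<le> s \<Longrightarrow> s < t + \<delta> \<Longrightarrow> \<phi> s < m"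
proof -
  have "(\<phi> \<longlongrightarrow> \<phi> t) (at_right t)"
    using assms(1) by (auto simp: nonneg_distribution_function_def continuous_within)
  then have "\<forall>\<^sub>F s in at_right t. \<phi> s < m" using assms(2) by (rule order_tendstoD)
  then obtain b where b: "t < b" "\<And>s. t < s \<Longrightarrow> s < b \<Longrightarrow> \<phi> s < m"
    by (auto simp: eventually_at_right_field)
  show ?thesis
  proof (rule that[of "b - t"])
    show "\<phi> s < m" if "t \<le> s" "s < t + (b - t)" for s
      using that b assms(2) by (cases "s = t") auto
  qed (use b in simp)
qed

text \<open>By right-continuity of \<open>F\<close> and monotonicity of \<open>G\<close>, a gap at one point persists on an interval to
  its right, which has positive length.\<close>
lemma laplace_transform_strict_mono:
  assumes F: "nonneg_distribution_function F" and G: "nonneg_distribution_function G"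
    and dom: "strictly_dominates F G" and k: "1 \<le> k"
  shows "laplace_transform F k < laplace_transform G k"
proof -
  have le: "F t \<le> G t" for t
    using dom F G by (cases "0 \<le> t") (auto simp: strictly_dominates_def nonneg_distribution_function_def)
  obtain t0 where t0: "F t0 < G t0"
    using dom le by (auto simp: strictly_dominates_def order_less_le)
  define m where "m = (F t0 + G t0) / 2"
  have m: "F t0 < m" "m < G t0" using t0 by (auto simp: m_def)
  obtain \<delta> where \<delta>: "0 < \<delta>" "\<And>s. t0 \<le> s \<Longrightarrow> s < t0 + \<delta> \<Longrightarrow> F s < m"
    using nonneg_distribution_function_at_right_less[OF F m(1)] by blast
  define c where "c = real k * exp (- (real k * (t0 + \<delta>))) * (G t0 - m)"
  have c: "0 < c" using k m by (simp add: c_def)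
  let ?w = "\<lambda>s. real k * exp (- (real k * s))"
  have [measurable]: "F \<in> borel_measurable borel"
    using F by (intro borel_measurable_mono) (simp add: nonneg_distribution_function_def)
  have nonneg: "0 \<le> ?w s * F s" for s
    using nonneg_distribution_function_nonneg[OF F] by simp
  have "ennreal (laplace_transform F k) + ennreal (c * \<delta>) =
      (\<integral>\<^sup>+s. ennreal (?w s * F s) \<partial>lborel) + (\<integral>\<^sup>+s. ennreal c * indicator {t0..<t0 + \<delta>} s \<partial>lborel)"
    using \<delta>(1) c by (simp add: laplace_transform_layer_cake[OF F k] nn_integral_cmult ennreal_mult)
  also have "\<dots> = (\<integral>\<^sup>+s. ennreal (?w s * F s) + ennreal c * indicator {t0..<t0 + \<delta>} s \<partial>lborel)"
    by (subst nn_integral_add) auto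
  also have "\<dots> \<le> (\<integral>\<^sup>+s. ennreal (?w s * G s) \<partial>lborel)"
  proof (rule nn_integral_mono)
    fix s
    show "ennreal (?w s * F s) + ennreal c * indicator {t0..<t0 + \<delta>} s \<le> ennreal (?w s * G s)"
    proof (cases "s \<in> {t0..<t0 + \<delta>}")
      case True
      have "G t0 \<le> G s" using True G by (auto simp: nonneg_distribution_function_def mono_def)
      with True \<delta>(2)[of s] have d: "G t0 - m \<le> G s - F s" by auto
      have "c \<le> ?w s * (G s - F s)"
        unfolding c_def using True d m k by (intro mult_mono) auto
      then have "?w s * F s + c \<le> ?w s * G s" by (simp add: algebra_simps)
      then have "ennreal (?w s * F s + c) \<le> ennreal (?w s * G s)" by (rule ennreal_leI)
      then show ?thesis using True nonneg[of s] c by (simp add: ennreal_plus)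
    next
      case False
      then show ?thesis using le[of s] by (simp add: ennreal_leI mult_left_mono)
    qed
  qed
  also have "\<dots> = ennreal (laplace_transform G k)" by (rule laplace_transform_layer_cake[OF G k, symmetric])
  finally have "ennreal (laplace_transform F k + c * \<delta>) \<le> ennreal (laplace_transform G k)"
    using laplace_sequence.pos[OF laplace_sequence_laplace_transform[OF F], of k] c \<delta>(1)
    by (simp add: less_imp_le)
  moreover have "0 \<le> laplace_transform G k"
    using laplace_sequence.pos[OF laplace_sequence_laplace_transform[OF G], of k] by simp
  ultimately have "laplace_transform F k + c * \<delta> \<le> laplace_transform G k" by simp
  moreover have "0 < c * \<delta>" using c \<delta>(1) by simp
  ultimately show ?thesis by simp
qed

text \<open>Split the integral at \<open>\<delta>\<close>.  As \<open>k\<close> grows and then \<open>\<delta>\<close> shrinks, the bound tends to the mass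
  of \<open>F\<close> at \<open>0\<close>.\<close>
lemma laplace_transform_le_atom:
  assumes F: "nonneg_distribution_function F" and "0 \<le> \<delta>"
  shows "laplace_transform F k \<le> F \<delta> + exp (- (real k * \<delta>))"
proof -
  interpret prob_space "interval_measure F" by (rule prob_space_interval_measure[OF F])
  have "measure (interval_measure F) {..\<delta>} = F \<delta>"
    using emeasure_interval_measure_atMost[OF F, of \<delta>] nonneg_distribution_function_nonneg[OF F, of \<delta>]
    by (simp add: measure_def)
  moreover have "laplace_transform F k \<le>
      (\<integral>t. indicator {..\<delta>} t + exp (- (real k * \<delta>)) \<partial>interval_measure F)"
    unfolding laplace_transform_def
  proof (rule integral_mono_AE[OF integrable_laplace[OF F]])
    show "AE t in interval_measure F. exp (- (real k * t)) \<le> indicator {..\<delta>} t + exp (- (real k * \<delta>))"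
      using AE_interval_measure_nonneg[OF F]
    proof (rule eventually_mono)
      fix t :: real assume "0 \<le> t"
      then have "exp (- (real k * t)) \<le> 1" by simp
      moreover have "exp (- (real k * t)) \<le> exp (- (real k * \<delta>))" if "\<delta> < t"
        using that by (simp add: mult_left_mono)
      ultimately show "exp (- (real k * t)) \<le> indicator {..\<delta>} t + exp (- (real k * \<delta>))"
        by (cases "t \<le> \<delta>") (auto intro: add_increasing2)
    qed
    show "integrable (interval_measure F) (\<lambda>t. indicat_real {..\<delta>} t + exp (- (real k * \<delta>)))"
      by (intro Bochner_Integration.integrable_add integrable_real_indicator) (auto simp: less_top[symmetric])
  qed
  moreover have "(\<integral>t. indicator {..\<delta>} t + exp (- (real k * \<delta>)) \<partial>interval_measure F) =
      measure (interval_measure F) {..\<delta>} + exp (- (real k * \<delta>))"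
    by (subst Bochner_Integration.integral_add)
       (auto simp: prob_space[simplified] less_top[symmetric] intro!: integrable_real_indicator)
  ultimately show ?thesis by simp
qed

text \<open>For large \<open>k\<close> the transform of \<open>F\<close> is below \<open>a\<close>, as it tends to \<open>F 0\<close>, and every \<open>s\<close> works.  For the
  finitely many other \<open>k\<close> the right-hand side tends to the transform of \<open>G\<close> as \<open>s\<close> tends to \<open>0\<close>.\<close>
lemma laplace_transform_interpolation:
  assumes F: "nonneg_distribution_function F" and G: "nonneg_distribution_function G"
    and dom: "strictly_dominates F G" and a: "F 0 < a"
  shows "\<exists>s>0. s < 1 \<and> (\<forall>k\<ge>1. laplace_transform F k \<le> laplace_transform G k powr (1 - s) * a powr s)"
proof -
  let ?F = "laplace_transform F" and ?G = "laplace_transform G"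
  have pos: "0 < ?F k" "0 < ?G k" for k
    using laplace_sequence.pos laplace_sequence_laplace_transform F G by blast+
  have a0: "0 < a" using a nonneg_distribution_function_nonneg[OF F, of 0] by simp
  define m where "m = (F 0 + a) / 2"
  have m: "F 0 < m" "m < a" using a by (auto simp: m_def)
  obtain \<delta>' where \<delta>': "0 < \<delta>'" "\<And>s. 0 \<le> s \<Longrightarrow> s < 0 + \<delta>' \<Longrightarrow> F s < m"
    using nonneg_distribution_function_at_right_less[OF F m(1)] by blast
  define \<delta> where "\<delta> = \<delta>' / 2"
  have \<delta>: "0 < \<delta>" "F \<delta> < m" using \<delta>' by (auto simp: \<delta>_def)
  obtain K where K: "- ln (a - m) / \<delta> < real K" using reals_Archimedean2 by blast
  have heavy: "?F k \<le> a" if "K \<le> k" for k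
  proof -
    have "- ln (a - m) < real K * \<delta>" using K \<delta> by (simp add: field_simps)
    also have "\<dots> \<le> real k * \<delta>" using that \<delta> by (intro mult_right_mono) auto
    finally have "exp (- (real k * \<delta>)) < a - m"
      using m exp_less_cancel_iff[of "- (real k * \<delta>)" "ln (a - m)"] by simp
    with laplace_transform_le_atom[OF F, of \<delta> k] \<delta> show ?thesis by simp
  qed
  have light: "\<forall>\<^sub>F s in at_right 0. ?F k \<le> ?G k powr (1 - s) * a powr s" if "k \<in> {1..<K}" for k
  proof -
    have "((\<lambda>s. ?G k powr (1 - s) * a powr s) \<longlongrightarrow> ?G k powr (1 - 0) * a powr 0) (at_right 0)"
      using pos[of k] a0 by (intro tendsto_intros) auto
    then have "((\<lambda>s. ?G k powr (1 - s) * a powr s) \<longlongrightarrow> ?G k) (at_right 0)"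
      using pos[of k] a0 by simp
    from order_tendstoD(1)[OF this laplace_transform_strict_mono[OF F G dom]] that
    show ?thesis by (auto elim: eventually_mono)
  qed
  have "\<forall>\<^sub>F s in at_right 0. \<forall>k\<in>{1..<K}. ?F k \<le> ?G k powr (1 - s) * a powr s"
    using light by (intro eventually_ball_finite) auto
  moreover have "\<forall>\<^sub>F s in at_right (0::real). s < 1" "\<forall>\<^sub>F s in at_right (0::real). 0 < s"
    by (auto simp: eventually_at_right_field intro!: exI[of _ 1])
  ultimately have "\<forall>\<^sub>F s in at_right 0. (\<forall>k\<in>{1..<K}. ?F k \<le> ?G k powr (1 - s) * a powr s) \<and> s < 1 \<and> 0 < s"
    by eventually_elim auto
  then obtain s where s: "\<forall>k\<in>{1..<K}. ?F k \<le> ?G k powr (1 - s) * a powr s" "s < 1" "0 < s"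
    using eventually_happens'[OF trivial_limit_at_right_real] by blast
  have "?F k \<le> ?G k powr (1 - s) * a powr s" if "1 \<le> k" for k
  proof (cases "k < K")
    case False
    have "?F k = ?F k powr (1 - s) * ?F k powr s"
      using pos[of k] by (simp flip: powr_add)
    also have "\<dots> \<le> ?G k powr (1 - s) * a powr s"
      using laplace_transform_strict_mono[OF F G dom that] heavy[of k] False pos[of k] s
      by (intro mult_mono powr_mono2) auto
    finally show ?thesis .
  qed (use s that in auto)
  with s show ?thesis by blast
qed

section \<open>Strict comparison of the Lyapunov exponents\<close>
lemma annealed_lyapunov_exponent_gap:
  fixes x :: "real ^ 'd::finite" and \<alpha> \<gamma> :: real
  assumes F: "nonneg_distribution_function F" and G: "nonneg_distribution_function G"
    and gap: "\<And>u :: int ^ 'd. annealed_cost F 0 u \<ge> \<alpha> * annealed_cost G 0 u + \<gamma> * \<bar>u $ i\<bar>"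
  shows "annealed_lyapunov_exponent F x \<ge> \<alpha> * annealed_lyapunov_exponent G x + \<gamma> * \<bar>x $ i\<bar>"
proof (rule tendsto_le)
  let ?u = "\<lambda>t. lattice_floor (t *\<^sub>R x)"
  show "((\<lambda>t. annealed_cost F 0 (?u t) / t) \<longlongrightarrow> annealed_lyapunov_exponent F x) at_top"
    by (rule annealed_lyapunov_exponent_tendsto[OF F])
  have "((\<lambda>t. real_of_int \<lfloor>t * x $ i\<rfloor> / t - x $ i) \<longlongrightarrow> 0) at_top"
  proof (rule Lim_null_comparison)
    show "\<forall>\<^sub>F t in at_top. norm (real_of_int \<lfloor>t * x $ i\<rfloor> / t - x $ i) \<le> 1 / t"
    proof (rule eventually_mono[OF eventually_gt_at_top[of 0]])
      fix t :: real assume t: "0 < t"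
      have "\<bar>real_of_int \<lfloor>t * x $ i\<rfloor> - t * x $ i\<bar> \<le> 1" by linarith
      then have "\<bar>real_of_int \<lfloor>t * x $ i\<rfloor> - t * x $ i\<bar> / t \<le> 1 / t" using t by (intro divide_right_mono) auto
      moreover have "real_of_int \<lfloor>t * x $ i\<rfloor> / t - x $ i = (real_of_int \<lfloor>t * x $ i\<rfloor> - t * x $ i) / t"
        using t by (simp add: diff_divide_distrib)
      ultimately show "norm (real_of_int \<lfloor>t * x $ i\<rfloor> / t - x $ i) \<le> 1 / t"
        using t by (simp add: abs_divide)
    qed
    show "((\<lambda>t::real. 1 / t) \<longlongrightarrow> 0) at_top"
      by (rule tendsto_divide_0[OF tendsto_const filterlim_at_top_imp_at_infinity[OF filterlim_ident]])
  qed
  from tendsto_add[OF this tendsto_const[of "x $ i"]]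
  have "((\<lambda>t. real_of_int \<lfloor>t * x $ i\<rfloor> / t) \<longlongrightarrow> x $ i) at_top" by simp
  from tendsto_add[OF tendsto_mult[OF tendsto_const[of \<alpha>] annealed_lyapunov_exponent_tendsto[OF G, of x]]
      tendsto_mult[OF tendsto_const[of \<gamma>] tendsto_rabs[OF this]]]
  show "((\<lambda>t. \<alpha> * (annealed_cost G 0 (?u t) / t) + \<gamma> * \<bar>real_of_int \<lfloor>t * x $ i\<rfloor> / t\<bar>) \<longlongrightarrow>
      \<alpha> * annealed_lyapunov_exponent G x + \<gamma> * \<bar>x $ i\<bar>) at_top" .
  show "\<forall>\<^sub>F t in at_top. \<alpha> * (annealed_cost G 0 (?u t) / t) + \<gamma> * \<bar>real_of_int \<lfloor>t * x $ i\<rfloor> / t\<bar>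
      \<le> annealed_cost F 0 (?u t) / t"
  proof (rule eventually_mono[OF eventually_gt_at_top[of 0]])
    fix t :: real assume t: "0 < t"
    have "\<alpha> * (annealed_cost G 0 (?u t) / t) + \<gamma> * \<bar>real_of_int \<lfloor>t * x $ i\<rfloor> / t\<bar> =
        (\<alpha> * annealed_cost G 0 (?u t) + \<gamma> * \<bar>?u t $ i\<bar>) / t"
      using t by (simp add: lattice_floor_def add_divide_distrib abs_divide)
    also have "\<dots> \<le> annealed_cost F 0 (?u t) / t"
      using t gap by (intro divide_right_mono) auto
    finally show "\<alpha> * (annealed_cost G 0 (?u t) / t) + \<gamma> * \<bar>real_of_int \<lfloor>t * x $ i\<rfloor> / t\<bar>
      \<le> annealed_cost F 0 (?u t) / t" .
  qed
qed simp

theorem theorem1p5: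
  fixes F G :: "real \<Rightarrow> real"
  assumes "nonneg_distribution_function F"
    and "nonneg_distribution_function G"
    and "strictly_dominates F G"
    and "CARD('d::finite) = 1 \<Longrightarrow>
      F 0 < exp (- annealed_lyapunov_exponent G (\<chi> i::'d. 1))"
  shows "\<exists>c>0. \<forall>x :: real ^ 'd. x \<noteq> 0 \<longrightarrow>
    annealed_lyapunov_exponent F x - annealed_lyapunov_exponent G x \<ge> c * (\<Sum>i\<in>UNIV. \<bar>x $ i\<bar>)"
proof -
  note F = assms(1) and G = assms(2) and dom = assms(3)
  let ?F = "laplace_transform F" and ?G = "laplace_transform G"
  note LF = laplace_sequence_laplace_transform[OF F] and LG = laplace_sequence_laplace_transform[OF G]
  note costs = annealed_cost_eq_passage_cost[OF F] annealed_cost_eq_passage_cost[OF G]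
  show ?thesis
  proof (cases "CARD('d) = 1")
    case True
    then obtain i :: 'd where i: "UNIV = {i}" by (auto simp: card_1_singleton_iff)
    define e where "e = ((\<chi> i. 1) :: real ^ 'd)"
    define \<beta> where "\<beta> = annealed_lyapunov_exponent G e"
    have sG: "seminorm (annealed_lyapunov_exponent G :: real ^ 'd \<Rightarrow> real)"
      using is_annealed_lyapunov_exponent[OF G, where 'd = 'd] by (simp add: is_annealed_lyapunov_exponent_def)
    have \<beta>: "0 \<le> \<beta>" "F 0 < exp (- \<beta>)"
      using sG assms(4)[OF True] by (auto simp: \<beta>_def e_def seminorm_def)
    define a where "a = (F 0 + exp (- \<beta>)) / 2"
    have a: "F 0 < a" "a < exp (- \<beta>)" "0 < a" "a \<le> 1"
    proof -
      have le1: "exp (- \<beta>) \<le> 1" using \<beta>(1) by simp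
      have F0: "0 \<le> F 0" by (rule nonneg_distribution_function_nonneg[OF F])
      show "F 0 < a" "a < exp (- \<beta>)" "0 < a"
        using \<beta>(2) F0 by (auto simp: a_def)
      then show "a \<le> 1" using le1 by (meson less_imp_le order_trans)
    qed
    obtain s where s: "0 < s" "s < 1" "\<And>k. 1 \<le> k \<Longrightarrow> ?F k \<le> ?G k powr (1 - s) * a powr s"
      using laplace_transform_interpolation[OF F G dom a(1)] by blast
    have "ln a < - \<beta>" using a(2,3) by (metis ln_exp ln_less_cancel_iff exp_gt_zero)
    then have c: "0 < s * (- ln a - \<beta>)" using s by simp
    have "annealed_lyapunov_exponent F x - annealed_lyapunov_exponent G x \<ge> s * (- ln a - \<beta>) * (\<Sum>i\<in>UNIV. \<bar>x $ i\<bar>)"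
      for x :: "real ^ 'd"
    proof -
      have "x = (x $ i) *\<^sub>R e" using i by (auto simp: vec_eq_iff e_def)
      then have x: "annealed_lyapunov_exponent G x = \<bar>x $ i\<bar> * \<beta>"
        using sG unfolding seminorm_def \<beta>_def by metis
      have "annealed_lyapunov_exponent F x \<ge> (1 - s) * annealed_lyapunov_exponent G x + (- s * ln a) * \<bar>x $ i\<bar>"
        using passage_cost_interpolation[OF LF LG s(1,2) a(3,4) s(3)]
        by (intro annealed_lyapunov_exponent_gap[OF F G]) (simp add: costs)
      then show ?thesis by (simp add: x i algebra_simps)
    qed
    with c show ?thesis by blast
  next
    case False
    have le: "?F k \<le> ?G k" for k
      using laplace_transform_strict_mono[OF F G dom, of k] laplace_sequence.zero[OF LF] laplace_sequence.zero[OF LG]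
      by (cases "k = 0") auto
    have less: "?F 1 < ?G 1" by (rule laplace_transform_strict_mono[OF F G dom]) simp
    define t where "t = (1 - ?F 1 / ?G 1) * (step_prob TYPE('d) * ?G 1) ^ 2"
    have t: "0 < t"
      using less laplace_sequence.pos[OF LG, of 1] step_prob_pos[where 'd = 'd] by (simp add: t_def)
    have gap: "annealed_lyapunov_exponent F x \<ge> 1 * annealed_lyapunov_exponent G x + ln (1 + t) * \<bar>x $ i\<bar>"
      for x :: "real ^ 'd" and i
    proof -
      have "\<exists>k. i \<noteq> k"
        using False by (metis (full_types) UNIV_I card_1_singleton_iff is_singletonI' is_singleton_altdef insert_not_empty singletonI UNIV_eq_I)
      then obtain k where "i \<noteq> k" by blast
      from passage_cost_gap_multidimensional[OF LF LG le less this]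
      show ?thesis
        by (intro annealed_lyapunov_exponent_gap[OF F G]) (simp add: costs t_def)
    qed
    define c where "c = ln (1 + t) / CARD('d)"
    have "annealed_lyapunov_exponent F x - annealed_lyapunov_exponent G x \<ge> c * (\<Sum>i\<in>UNIV. \<bar>x $ i\<bar>)"
      for x :: "real ^ 'd"
    proof -
      have "(\<Sum>i\<in>(UNIV :: 'd set). ln (1 + t) * \<bar>x $ i\<bar>) \<le>
          real CARD('d) * (annealed_lyapunov_exponent F x - annealed_lyapunov_exponent G x)"
        using gap[of x] sum_bounded_above[of UNIV "\<lambda>i. ln (1 + t) * \<bar>x $ i\<bar>"
            "annealed_lyapunov_exponent F x - annealed_lyapunov_exponent G x"]
        by (simp add: algebra_simps)
      then have "ln (1 + t) * (\<Sum>i\<in>UNIV. \<bar>x $ i\<bar>) \<le>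
          (annealed_lyapunov_exponent F x - annealed_lyapunov_exponent G x) * real CARD('d)"
        by (simp only: sum_distrib_left mult.commute[of "real CARD('d)"])
      then have "ln (1 + t) * (\<Sum>i\<in>UNIV. \<bar>x $ i\<bar>) / real CARD('d) \<le>
          annealed_lyapunov_exponent F x - annealed_lyapunov_exponent G x"
        by (subst pos_divide_le_eq) auto
      then show ?thesis by (simp add: c_def)
    qed
    moreover have "0 < c" using t by (simp add: c_def)
    ultimately show ?thesis by blast
  qed
qed

end
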